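(* Let $(M_1,g_1)$ and $(M_2,g_2)$ be pseudo-Riemannian manifolds, let $f:M_1\to(0,\infty)$ be smooth, and let $(M,g)=(M_1\times_f M_2,\ g_1\oplus f^2g_2)$. Let $\zeta=\zeta_1+\zeta_2$ with $\zeta_i\in\mathfrak{X}(M_i)$ (lifted to $M$), let $\lambda\in\mathbb{R}$, and suppose that $(M,g,\zeta,\lambda)$ is a Ricci soliton. Then $(M,g)$ is Einstein if one of the following conditions holds: (1) $\zeta_i$ is conformal on $(M_i,g_i)$ with factor $2\rho_i$ for $i=1,2$, and $\rho_1=\rho_2+\zeta_1(\ln f)$; (2) $\zeta=\zeta_1$ and $\zeta_1$ is a Killing vector field on $M_1$; (3) $\zeta=\zeta_2$ and $\zeta_2$ is a Killing vector field on $M_2$; (4) $\zeta_i$ is a Killing vector field on $M_i$ for $i=1,2$, and $\zeta_1(f)=0$.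
   Context: A Ricci soliton $(N,h,\xi,\lambda)$ is a pseudo-Riemannian manifold $(N,h)$ with a vector field $\xi$ and a real constant $\lambda$ such that $\frac12\mathcal{L}_\xi h+\mathrm{Ric}=\lambda h$. The warped product $M_1\times_f M_2$ is $M_1\times M_2$ with metric $\pi_1^*g_1+(f\circ\pi_1)^2\pi_2^*g_2$; tensor fields on the factors and their lifts are denoted by the same symbol, and the identity in (1) is between functions on $M_1\times M_2$. A vector field $\xi$ is conformal with factor $2\rho$ if $\mathcal{L}_\xi h=2\rho h$ for a smooth function $\rho$, and Killing if $\mathcal{L}_\xi h=0$. A manifold $(N,h)$ is Einstein with factor $\mu$ if $\mathrm{Ric}=\mu h$; here $\mu$ is a smooth function that is not required a priori to be constant (in the paper's usage, a Ricci soliton $(N,h,\xi,\lambda)$ is Einstein with factor $\lambda-\rho$ if and only if $\xi$ is conformal with factor $2\rho$). *)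

theory Defs
  imports "HOL-Analysis.Analysis"
begin

section \<open>Smooth maps between Euclidean spaces\<close>

text \<open>Used for open sets \<open>S\<close> only: all iterated directional derivatives up to order \<open>k\<close> exist
  and are continuous on \<open>S\<close>.\<close>

primrec Ck_on ::
  "nat \<Rightarrow> 'a::euclidean_space set \<Rightarrow> ('a \<Rightarrow> 'b::real_normed_vector) \<Rightarrow> bool" where
  "Ck_on 0 S f \<longleftrightarrow> continuous_on S f"
| "Ck_on (Suc k) S f \<longleftrightarrow>
     (\<forall>x\<in>S. f differentiable (at x)) \<and> (\<forall>v. Ck_on k S (\<lambda>x. frechet_derivative f (at x) v))"

definition smooth_on ::
  "'a::euclidean_space set \<Rightarrow> ('a \<Rightarrow> 'b::real_normed_vector) \<Rightarrow> bool" where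
  "smooth_on S f \<longleftrightarrow> (\<forall>k. Ck_on k S f)"


section \<open>Smooth manifolds\<close>

text \<open>A manifold is given by an indexed atlas. Its underlying set is the union of the chart domains
  (an open subset of the topological space \<open>'m\<close>), and its dimension is \<open>DIM('e)\<close>.\<close>

record ('i, 'm, 'e) atlas =
  charts :: "'i set"
  chart_dom :: "'i \<Rightarrow> 'm set"
  chart_map :: "'i \<Rightarrow> 'm \<Rightarrow> 'e"

definition carrier :: "('i, 'm, 'e) atlas \<Rightarrow> 'm set" where
  "carrier A = (\<Union>i\<in>charts A. chart_dom A i)"

definition chart_img :: "('i, 'm, 'e) atlas \<Rightarrow> 'i \<Rightarrow> 'e set" where
  "chart_img A i = chart_map A i ` chart_dom A i"

definition chart_inv :: "('i, 'm, 'e) atlas \<Rightarrow> 'i \<Rightarrow> 'e \<Rightarrow> 'm" where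
  "chart_inv A i = inv_into (chart_dom A i) (chart_map A i)"

definition overlap :: "('i, 'm, 'e) atlas \<Rightarrow> 'i \<Rightarrow> 'i \<Rightarrow> 'e set" where
  "overlap A i j = chart_map A i ` (chart_dom A i \<inter> chart_dom A j)"

definition transition :: "('i, 'm, 'e) atlas \<Rightarrow> 'i \<Rightarrow> 'i \<Rightarrow> 'e \<Rightarrow> 'e" where
  "transition A i j = (\<lambda>x. chart_map A j (chart_inv A i x))"

definition smooth_manifold ::
  "('i, 'm::{t2_space, second_countable_topology}, 'e::euclidean_space) atlas \<Rightarrow> bool" where
  "smooth_manifold A \<longleftrightarrow>
     (\<forall>i\<in>charts A. open (chart_dom A i) \<and> open (chart_img A i) \<and>
        homeomorphism (chart_dom A i) (chart_img A i) (chart_map A i) (chart_inv A i)) \<and>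
     (\<forall>i\<in>charts A. \<forall>j\<in>charts A. smooth_on (overlap A i j) (transition A i j))"

definition smooth_function ::
  "('i, 'm, 'e::euclidean_space) atlas \<Rightarrow> ('m \<Rightarrow> real) \<Rightarrow> bool" where
  "smooth_function A h \<longleftrightarrow> (\<forall>i\<in>charts A. smooth_on (chart_img A i) (\<lambda>x. h (chart_inv A i x)))"


section \<open>Tensor fields\<close>

text \<open>A tensor field is the family of its local representatives, one for every chart \<open>i\<close>, subject
  to the transformation law on overlaps. The representative in chart \<open>i\<close> is a function of the
  coordinates, i.e. of a point of \<open>chart_img A i\<close>; tangent vectors are identified with elements
  of \<open>'e\<close> by means of the coordinate frame.\<close>

type_synonym ('i, 'e) vfield = "'i \<Rightarrow> 'e \<Rightarrow> 'e"
type_synonym ('i, 'e) tensor2 = "'i \<Rightarrow> 'e \<Rightarrow> 'e \<Rightarrow> 'e \<Rightarrow> real"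

definition vector_field ::
  "('i, 'm, 'e::euclidean_space) atlas \<Rightarrow> ('i, 'e) vfield \<Rightarrow> bool" where
  "vector_field A X \<longleftrightarrow>
     (\<forall>i\<in>charts A. smooth_on (chart_img A i) (X i)) \<and>
     (\<forall>i\<in>charts A. \<forall>j\<in>charts A. \<forall>x\<in>overlap A i j.
        X j (transition A i j x) = frechet_derivative (transition A i j) (at x) (X i x))"

definition eq_vf ::
  "('i, 'm, 'e) atlas \<Rightarrow> ('i, 'e) vfield \<Rightarrow> ('i, 'e) vfield \<Rightarrow> bool" where
  "eq_vf A X Y \<longleftrightarrow> (\<forall>i\<in>charts A. \<forall>x\<in>chart_img A i. X i x = Y i x)"

definition add_vf :: "('i, 'e::plus) vfield \<Rightarrow> ('i, 'e) vfield \<Rightarrow> ('i, 'e) vfield" where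
  "add_vf X Y = (\<lambda>i x. X i x + Y i x)"

text \<open>The function \<open>X(h)\<close>. The value does not depend on the chart around \<open>p\<close>
  (see \<open>vf_act_chart\<close> below).\<close>

definition vf_act ::
  "('i, 'm, 'e::euclidean_space) atlas \<Rightarrow> ('i, 'e) vfield \<Rightarrow> ('m \<Rightarrow> real) \<Rightarrow> 'm \<Rightarrow> real" where
  "vf_act A X h p =
     (let i = (SOME i. i \<in> charts A \<and> p \<in> chart_dom A i); x = chart_map A i p
      in frechet_derivative (\<lambda>y. h (chart_inv A i y)) (at x) (X i x))"

definition pseudo_riemannian ::
  "('i, 'm::{t2_space, second_countable_topology}, 'e::euclidean_space) atlas
     \<Rightarrow> ('i, 'e) tensor2 \<Rightarrow> bool" where
  "pseudo_riemannian A g \<longleftrightarrow> smooth_manifold A \<and>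
     (\<forall>i\<in>charts A. \<forall>v w. smooth_on (chart_img A i) (\<lambda>x. g i x v w)) \<and>
     (\<forall>i\<in>charts A. \<forall>x\<in>chart_img A i. bilinear (g i x) \<and>
        (\<forall>v w. g i x v w = g i x w v) \<and>
        (\<forall>v. (\<forall>w. g i x v w = 0) \<longrightarrow> v = 0)) \<and>
     (\<forall>i\<in>charts A. \<forall>j\<in>charts A. \<forall>x\<in>overlap A i j. \<forall>v w.
        g i x v w = g j (transition A i j x) (frechet_derivative (transition A i j) (at x) v)
                                             (frechet_derivative (transition A i j) (at x) w))"


section \<open>Lie derivative and Ricci curvature in a chart\<close>

text \<open>Here \<open>G\<close> and \<open>X\<close> are the local representatives of a metric and of a vector field, and \<open>v\<close>,
  \<open>w\<close>, \<open>u\<close>, \<open>b\<close> stand for the corresponding constant-coefficient vector fields, which commute.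
  Both constructions are tensorial, so an equation between them holds on the manifold if and only
  if it holds in every chart of the given atlas.\<close>

text \<open>This is \<open>X(G(v,w)) - G([X,v],w) - G(v,[X,w])\<close>, where \<open>[X,v] = - DX(v)\<close> as \<open>v\<close> is constant.\<close>

definition lie_metric ::
  "('e::euclidean_space \<Rightarrow> 'e) \<Rightarrow> ('e \<Rightarrow> 'e \<Rightarrow> 'e \<Rightarrow> real) \<Rightarrow> 'e \<Rightarrow> 'e \<Rightarrow> 'e \<Rightarrow> real" where
  "lie_metric X G x v w =
     frechet_derivative (\<lambda>y. G y v w) (at x) (X x)
     + G x (frechet_derivative X (at x) v) w
     + G x v (frechet_derivative X (at x) w)"

text \<open>The vector \<open>\<nabla>\<^sub>v w\<close> at \<open>x\<close> for the Levi-Civita connection, determined by the Koszul formula.\<close>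

definition levi_civita ::
  "('e::euclidean_space \<Rightarrow> 'e \<Rightarrow> 'e \<Rightarrow> real) \<Rightarrow> 'e \<Rightarrow> 'e \<Rightarrow> 'e \<Rightarrow> 'e" where
  "levi_civita G x v w =
     (THE u. \<forall>z. 2 * G x u z =
        frechet_derivative (\<lambda>y. G y w z) (at x) v
        + frechet_derivative (\<lambda>y. G y v z) (at x) w
        - frechet_derivative (\<lambda>y. G y v w) (at x) z)"

text \<open>\<open>R(u,v)w = \<nabla>\<^sub>u \<nabla>\<^sub>v w - \<nabla>\<^sub>v \<nabla>\<^sub>u w\<close>, where \<open>\<nabla>\<^sub>u Z = DZ(u) + \<nabla>\<^sub>u (Z x)\<close> for a non-constant field \<open>Z\<close>.\<close>

definition riemann ::
  "('e::euclidean_space \<Rightarrow> 'e \<Rightarrow> 'e \<Rightarrow> real) \<Rightarrow> 'e \<Rightarrow> 'e \<Rightarrow> 'e \<Rightarrow> 'e \<Rightarrow> 'e" where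
  "riemann G x u v w =
     frechet_derivative (\<lambda>y. levi_civita G y v w) (at x) u
     + levi_civita G x u (levi_civita G x v w)
     - frechet_derivative (\<lambda>y. levi_civita G y u w) (at x) v
     - levi_civita G x v (levi_civita G x u w)"

text \<open>\<open>Ric(v,w)\<close> is the trace of \<open>b \<mapsto> R(b,v)w\<close>; a trace can be computed in any basis, and the inner
  product of \<open>'e\<close> plays no role beyond reading off components.\<close>

definition ricci ::
  "('e::euclidean_space \<Rightarrow> 'e \<Rightarrow> 'e \<Rightarrow> real) \<Rightarrow> 'e \<Rightarrow> 'e \<Rightarrow> 'e \<Rightarrow> real" where
  "ricci G x v w = (\<Sum>b\<in>Basis. riemann G x b v w \<bullet> b)"


section \<open>Ricci solitons, Einstein manifolds, conformal and Killing fields\<close>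

definition ricci_soliton ::
  "('i, 'm::{t2_space, second_countable_topology}, 'e::euclidean_space) atlas
     \<Rightarrow> ('i, 'e) tensor2 \<Rightarrow> ('i, 'e) vfield \<Rightarrow> real \<Rightarrow> bool" where
  "ricci_soliton A h \<xi> c \<longleftrightarrow> pseudo_riemannian A h \<and> vector_field A \<xi> \<and>
     (\<forall>i\<in>charts A. \<forall>x\<in>chart_img A i. \<forall>v w.
        1/2 * lie_metric (\<xi> i) (h i) x v w + ricci (h i) x v w = c * h i x v w)"

definition einstein_with_factor ::
  "('i, 'm::{t2_space, second_countable_topology}, 'e::euclidean_space) atlas
     \<Rightarrow> ('i, 'e) tensor2 \<Rightarrow> ('m \<Rightarrow> real) \<Rightarrow> bool" where
  "einstein_with_factor A h \<mu> \<longleftrightarrow> pseudo_riemannian A h \<and> smooth_function A \<mu> \<and>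
     (\<forall>i\<in>charts A. \<forall>x\<in>chart_img A i. \<forall>v w.
        ricci (h i) x v w = \<mu> (chart_inv A i x) * h i x v w)"

definition einstein ::
  "('i, 'm::{t2_space, second_countable_topology}, 'e::euclidean_space) atlas
     \<Rightarrow> ('i, 'e) tensor2 \<Rightarrow> bool" where
  "einstein A h \<longleftrightarrow> (\<exists>\<mu>. einstein_with_factor A h \<mu>)"

text \<open>\<open>conformal_field A h \<xi> \<rho>\<close> says that \<open>\<xi>\<close> is conformal with factor \<open>2\<rho>\<close>.\<close>

definition conformal_field ::
  "('i, 'm::{t2_space, second_countable_topology}, 'e::euclidean_space) atlas
     \<Rightarrow> ('i, 'e) tensor2 \<Rightarrow> ('i, 'e) vfield \<Rightarrow> ('m \<Rightarrow> real) \<Rightarrow> bool" where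
  "conformal_field A h \<xi> \<rho> \<longleftrightarrow> smooth_function A \<rho> \<and>
     (\<forall>i\<in>charts A. \<forall>x\<in>chart_img A i. \<forall>v w.
        lie_metric (\<xi> i) (h i) x v w = 2 * \<rho> (chart_inv A i x) * h i x v w)"

definition killing_field ::
  "('i, 'm::{t2_space, second_countable_topology}, 'e::euclidean_space) atlas
     \<Rightarrow> ('i, 'e) tensor2 \<Rightarrow> ('i, 'e) vfield \<Rightarrow> bool" where
  "killing_field A h \<xi> \<longleftrightarrow>
     (\<forall>i\<in>charts A. \<forall>x\<in>chart_img A i. \<forall>v w. lie_metric (\<xi> i) (h i) x v w = 0)"


section \<open>Warped products\<close>

definition prod_atlas ::
  "('i, 'm, 'd) atlas \<Rightarrow> ('j, 'n, 'e) atlas \<Rightarrow> ('i \<times> 'j, 'm \<times> 'n, 'd \<times> 'e) atlas" where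
  "prod_atlas A B =
     \<lparr> charts = charts A \<times> charts B,
       chart_dom = (\<lambda>k. chart_dom A (fst k) \<times> chart_dom B (snd k)),
       chart_map = (\<lambda>k. map_prod (chart_map A (fst k)) (chart_map B (snd k))) \<rparr>"

definition warped_metric ::
  "('i, 'm, 'd) atlas \<Rightarrow> ('m \<Rightarrow> real) \<Rightarrow> ('i, 'd) tensor2 \<Rightarrow> ('j, 'e) tensor2
     \<Rightarrow> ('i \<times> 'j, 'd \<times> 'e) tensor2" where
  "warped_metric A f g1 g2 = (\<lambda>k z v w.
     g1 (fst k) (fst z) (fst v) (fst w)
     + (f (chart_inv A (fst k) (fst z)))\<^sup>2 * g2 (snd k) (snd z) (snd v) (snd w))"

definition lift1 :: "('i, 'd) vfield \<Rightarrow> ('i \<times> 'j, 'd \<times> 'e::zero) vfield" where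
  "lift1 X = (\<lambda>k z. (X (fst k) (fst z), 0))"

definition lift2 :: "('j, 'e) vfield \<Rightarrow> ('i \<times> 'j, 'd::zero \<times> 'e) vfield" where
  "lift2 Y = (\<lambda>k z. (0, Y (snd k) (snd z)))"


section \<open>Well-definedness of the constructions\<close>

lemma Ck_on_cong:
  assumes "open S" "\<And>x. x \<in> S \<Longrightarrow> f x = g x"
  shows "Ck_on k S f \<longleftrightarrow> Ck_on k S g"
  using assms(2)
proof (induction k arbitrary: f g)
  case 0
  then show ?case by (auto cong: continuous_on_cong)
next
  case (Suc k)
  have *: "(f has_derivative D) (at x) \<longleftrightarrow> (g has_derivative D) (at x)" if "x \<in> S" for x D
    using that Suc.prems assms(1)
      has_derivative_transform_within_open[of f D x UNIV S g]
      has_derivative_transform_within_open[of g D x UNIV S f] by auto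
  have "frechet_derivative f (at x) = frechet_derivative g (at x)" if "x \<in> S" for x
    using *[OF that] by (simp add: frechet_derivative_def)
  then have "Ck_on k S (\<lambda>x. frechet_derivative f (at x) v)
      \<longleftrightarrow> Ck_on k S (\<lambda>x. frechet_derivative g (at x) v)" for v
    by (intro Suc.IH) auto
  with * show ?case by (auto simp: differentiable_def)
qed

lemma Ck_on_SucD: "Ck_on (Suc k) S f \<Longrightarrow> Ck_on k S f"
proof (induction k arbitrary: f)
  case 0
  then show ?case
    by (auto intro!: continuous_at_imp_continuous_on differentiable_imp_continuous_within)
next
  case (Suc k)
  then show ?case by auto
qed

lemma Ck_on_SucI:
  assumes "open S" "\<And>x. x \<in> S \<Longrightarrow> (f has_derivative F x) (at x)" "\<And>v. Ck_on k S (\<lambda>x. F x v)"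
  shows "Ck_on (Suc k) S f"
proof -
  have "frechet_derivative f (at x) = F x" if "x \<in> S" for x
    using assms(2)[OF that] by (metis frechet_derivative_at)
  then have "Ck_on k S (\<lambda>x. frechet_derivative f (at x) v)" for v
    using Ck_on_cong[OF assms(1), of "\<lambda>x. frechet_derivative f (at x) v" "\<lambda>x. F x v"] assms(3)
    by auto
  then show ?thesis using assms(2) by (auto simp: differentiable_def)
qed

lemma Ck_on_SucE:
  assumes "Ck_on (Suc k) S f"
  shows "\<And>x. x \<in> S \<Longrightarrow> (f has_derivative frechet_derivative f (at x)) (at x)"
    "\<And>v. Ck_on k S (\<lambda>x. frechet_derivative f (at x) v)" "Ck_on k S f"
  using assms Ck_on_SucD[OF assms] by (auto simp: frechet_derivative_works)

lemma Ck_on_const: "open S \<Longrightarrow> Ck_on k S (\<lambda>x. a)"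
  by (induction k arbitrary: a) (auto intro!: Ck_on_SucI[where F = "\<lambda>x v. 0"] simp del: Ck_on.simps(2))

lemma Ck_on_add:
  assumes "open S" "Ck_on k S f" "Ck_on k S g"
  shows "Ck_on k S (\<lambda>x. f x + g x)"
  using assms(2,3)
proof (induction k arbitrary: f g)
  case 0
  then show ?case by (auto intro: continuous_on_add)
next
  case (Suc k)
  note f = Ck_on_SucE[OF Suc.prems(1)] and g = Ck_on_SucE[OF Suc.prems(2)]
  show ?case
    by (rule Ck_on_SucI[OF assms(1) has_derivative_add[OF f(1) g(1)]])
      (auto intro: Suc.IH f(2) g(2))
qed

lemma Ck_on_mult:
  fixes f g :: "'a::euclidean_space \<Rightarrow> real"
  assumes "open S" "Ck_on k S f" "Ck_on k S g"
  shows "Ck_on k S (\<lambda>x. f x * g x)"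
  using assms(2,3)
proof (induction k arbitrary: f g)
  case 0
  then show ?case by (auto intro: continuous_on_mult)
next
  case (Suc k)
  note f = Ck_on_SucE[OF Suc.prems(1)] and g = Ck_on_SucE[OF Suc.prems(2)]
  show ?case
    by (rule Ck_on_SucI[OF assms(1) has_derivative_mult[OF f(1) g(1)]])
      (auto intro!: Ck_on_add[OF assms(1)] Suc.IH f g)
qed

lemma Ck_on_linear_image:
  assumes "open S" "bounded_linear L" "Ck_on k S f"
  shows "Ck_on k S (\<lambda>x. L (f x))"
  using assms(3)
proof (induction k arbitrary: f)
  case 0
  then show ?case using bounded_linear.continuous_on[OF assms(2)] by auto
next
  case (Suc k)
  note f = Ck_on_SucE[OF Suc.prems(1)]
  show ?case
    by (rule Ck_on_SucI[OF assms(1) bounded_linear.has_derivative[OF assms(2) f(1)]])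
      (auto intro!: Suc.IH f)
qed

lemma Ck_on_compose_linear:
  assumes "open T" "bounded_linear L" "L ` T \<subseteq> S" "Ck_on k S f"
  shows "Ck_on k T (\<lambda>x. f (L x))"
  using assms(4)
proof (induction k arbitrary: f)
  case 0
  have "continuous_on T L"
    by (rule linear_continuous_on[OF assms(2)])
  then show ?case using 0 assms(3) by (auto intro: continuous_on_compose2)
next
  case (Suc k)
  note f = Ck_on_SucE[OF Suc.prems(1)]
  have "((\<lambda>x. f (L x)) has_derivative (\<lambda>v. frechet_derivative f (at (L x)) (L v))) (at x)"
    if "x \<in> T" for x
    using has_derivative_compose[OF bounded_linear_imp_has_derivative[OF assms(2)] f(1)] that assms(3)
    by blast
  then show ?case
    by (rule Ck_on_SucI[OF assms(1)]) (auto intro!: Suc.IH f)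
qed

lemma smooth_on_cong:
  "open S \<Longrightarrow> (\<And>x. x \<in> S \<Longrightarrow> f x = g x) \<Longrightarrow> smooth_on S f \<longleftrightarrow> smooth_on S g"
  using Ck_on_cong[of S f g] by (auto simp: smooth_on_def)

lemma smooth_on_imp_has_derivative:
  "smooth_on S f \<Longrightarrow> x \<in> S \<Longrightarrow> (f has_derivative frechet_derivative f (at x)) (at x)"
  using Ck_on_SucE(1)[of 0 S f x] by (auto simp: smooth_on_def simp del: Ck_on.simps)

lemma smooth_on_compose_linear:
  "open T \<Longrightarrow> bounded_linear L \<Longrightarrow> L ` T \<subseteq> S \<Longrightarrow> smooth_on S f \<Longrightarrow> smooth_on T (\<lambda>x. f (L x))"
  unfolding smooth_on_def using Ck_on_compose_linear by blast

lemma smooth_on_Pair: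
  assumes "open S" "open T" "smooth_on S f" "smooth_on T g"
  shows "smooth_on (S \<times> T) (\<lambda>z. (f (fst z), g (snd z)))"
proof -
  have "Ck_on k (S \<times> T) (\<lambda>z. (f (fst z), 0) + (0, g (snd z)))" for k
  proof (rule Ck_on_add)
    show op: "open (S \<times> T)" using assms by (simp add: open_Times)
    have f: "Ck_on k (S \<times> T) (\<lambda>z. f (fst z))"
      by (rule Ck_on_compose_linear[OF op bounded_linear_fst, of S])
        (use assms in \<open>auto simp: smooth_on_def\<close>)
    have g: "Ck_on k (S \<times> T) (\<lambda>z. g (snd z))"
      by (rule Ck_on_compose_linear[OF op bounded_linear_snd, of T])
        (use assms in \<open>auto simp: smooth_on_def\<close>)
    show "Ck_on k (S \<times> T) (\<lambda>z. (f (fst z), 0))"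
      using Ck_on_linear_image[OF op bounded_linear_Pair[OF bounded_linear_ident bounded_linear_zero] f] .
    show "Ck_on k (S \<times> T) (\<lambda>z. (0, g (snd z)))"
      using Ck_on_linear_image[OF op bounded_linear_Pair[OF bounded_linear_zero bounded_linear_ident] g] .
  qed
  then show ?thesis by (simp add: smooth_on_def)
qed

lemma chart_inv_map:
  "smooth_manifold A \<Longrightarrow> i \<in> charts A \<Longrightarrow> p \<in> chart_dom A i \<Longrightarrow> chart_inv A i (chart_map A i p) = p"
  by (auto simp: smooth_manifold_def homeomorphism_def)

lemma chart_map_inv:
  "smooth_manifold A \<Longrightarrow> i \<in> charts A \<Longrightarrow> x \<in> chart_img A i \<Longrightarrow> chart_map A i (chart_inv A i x) = x"
  by (auto simp: smooth_manifold_def homeomorphism_def)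

lemma chart_inv_in:
  "x \<in> chart_img A i \<Longrightarrow> chart_inv A i x \<in> chart_dom A i"
  by (auto simp: chart_inv_def chart_img_def intro: inv_into_into)

lemma open_chart_img: "smooth_manifold A \<Longrightarrow> i \<in> charts A \<Longrightarrow> open (chart_img A i)"
  by (auto simp: smooth_manifold_def)

lemma open_overlap:
  assumes "smooth_manifold A" "i \<in> charts A" "j \<in> charts A"
  shows "open (overlap A i j)"
proof -
  have h: "homeomorphism (chart_dom A i) (chart_img A i) (chart_map A i) (chart_inv A i)"
    and o: "open (chart_dom A i)" "open (chart_img A i)" "open (chart_dom A j)"
    using assms by (auto simp: smooth_manifold_def)
  have "openin (top_of_set (chart_img A i)) (chart_map A i ` (chart_dom A i \<inter> chart_dom A j))"
    by (rule homeomorphism_imp_open_map[OF h]) (use o in \<open>auto simp: openin_open\<close>)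
  then show ?thesis using o by (auto simp: overlap_def openin_open_eq)
qed

lemma overlap_subset: "overlap A i j \<subseteq> chart_img A i"
  by (auto simp: overlap_def chart_img_def)

lemma smooth_transition:
  "smooth_manifold A \<Longrightarrow> i \<in> charts A \<Longrightarrow> j \<in> charts A \<Longrightarrow> smooth_on (overlap A i j) (transition A i j)"
  by (auto simp: smooth_manifold_def)

lemma vf_act_chart:
  assumes A: "smooth_manifold A" and X: "vector_field A X" and h: "smooth_function A h"
    and i: "i \<in> charts A" and p: "p \<in> chart_dom A i"
  shows "vf_act A X h p =
    frechet_derivative (\<lambda>y. h (chart_inv A i y)) (at (chart_map A i p)) (X i (chart_map A i p))"
proof -
  define j where "j = (SOME j. j \<in> charts A \<and> p \<in> chart_dom A j)"
  have j: "j \<in> charts A" "p \<in> chart_dom A j"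
    using someI[of "\<lambda>j. j \<in> charts A \<and> p \<in> chart_dom A j" i] i p by (auto simp: j_def)
  let ?x = "chart_map A j p" and ?y = "chart_map A i p" and ?t = "transition A j i"
  let ?hi = "\<lambda>y. h (chart_inv A i y)" and ?hj = "\<lambda>y. h (chart_inv A j y)"
  have x: "?x \<in> overlap A j i" using j p by (auto simp: overlap_def)
  have t: "?t ?x = ?y" using chart_inv_map[OF A j] by (simp add: transition_def)
  have "(?t has_derivative frechet_derivative ?t (at ?x)) (at ?x)"
    using smooth_transition[OF A j(1) i] x by (rule smooth_on_imp_has_derivative)
  moreover have "(?hi has_derivative frechet_derivative ?hi (at ?y)) (at ?y)"
    by (rule smooth_on_imp_has_derivative[of "chart_img A i"])
      (use h i p in \<open>auto simp: smooth_function_def chart_img_def\<close>)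
  ultimately have "((\<lambda>z. ?hi (?t z)) has_derivative
      (\<lambda>v. frechet_derivative ?hi (at ?y) (frechet_derivative ?t (at ?x) v))) (at ?x)"
    using has_derivative_compose[of ?t _ ?x UNIV ?hi] t by simp
  then have "(?hj has_derivative
      (\<lambda>v. frechet_derivative ?hi (at ?y) (frechet_derivative ?t (at ?x) v))) (at ?x)"
  proof (rule has_derivative_transform_within_open[OF _ open_overlap[OF A j(1) i] x])
    fix z assume "z \<in> overlap A j i"
    then show "?hi (?t z) = ?hj z"
      using chart_inv_map[OF A j(1)] chart_inv_map[OF A i] by (auto simp: overlap_def transition_def)
  qed
  then have "frechet_derivative ?hj (at ?x) (X j ?x)
      = frechet_derivative ?hi (at ?y) (frechet_derivative ?t (at ?x) (X j ?x))"
    by (metis frechet_derivative_at)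
  also have "frechet_derivative ?t (at ?x) (X j ?x) = X i ?y"
    using X i j x t unfolding vector_field_def by metis
  finally show ?thesis by (simp add: vf_act_def Let_def flip: j_def)
qed

lemma prod_atlas_simps [simp]:
  "charts (prod_atlas A B) = charts A \<times> charts B"
  "chart_dom (prod_atlas A B) k = chart_dom A (fst k) \<times> chart_dom B (snd k)"
  "chart_map (prod_atlas A B) k z = (chart_map A (fst k) (fst z), chart_map B (snd k) (snd z))"
  "chart_img (prod_atlas A B) k = chart_img A (fst k) \<times> chart_img B (snd k)"
  "overlap (prod_atlas A B) k l = overlap A (fst k) (fst l) \<times> overlap B (snd k) (snd l)"
  by (force simp: prod_atlas_def chart_img_def overlap_def map_prod_def split_beta)+

lemma prod_chart_inv:
  assumes "smooth_manifold A" "smooth_manifold B" "k \<in> charts A \<times> charts B"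
    and "z \<in> chart_img A (fst k) \<times> chart_img B (snd k)"
  shows "chart_inv (prod_atlas A B) k z = (chart_inv A (fst k) (fst z), chart_inv B (snd k) (snd z))"
proof -
  let ?w = "(chart_inv A (fst k) (fst z), chart_inv B (snd k) (snd z))"
  have w: "?w \<in> chart_dom (prod_atlas A B) k" "chart_map (prod_atlas A B) k ?w = z"
    using assms by (auto simp: chart_inv_in chart_map_inv)
  have "inj_on (chart_map (prod_atlas A B) k) (chart_dom (prod_atlas A B) k)"
    using assms(3) chart_inv_map[OF assms(1)] chart_inv_map[OF assms(2)]
    by (intro inj_on_inverseI[where g = "\<lambda>z. (chart_inv A (fst k) (fst z), chart_inv B (snd k) (snd z))"])
      auto
  from inv_into_f_f[OF this w(1)] show ?thesis
    unfolding w(2) chart_inv_def[of "prod_atlas A B"] .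
qed

lemma transition_prod:
  assumes "smooth_manifold A" "smooth_manifold B" "k \<in> charts A \<times> charts B"
    and "z \<in> overlap A (fst k) (fst l) \<times> overlap B (snd k) (snd l)"
  shows "transition (prod_atlas A B) k l z
    = (transition A (fst k) (fst l) (fst z), transition B (snd k) (snd l) (snd z))"
proof -
  have "z \<in> chart_img A (fst k) \<times> chart_img B (snd k)"
    using assms(4) overlap_subset[of A "fst k"] overlap_subset[of B "snd k"] by auto
  then show ?thesis
    using prod_chart_inv[OF assms(1-3)] by (simp add: transition_def)
qed

lemma smooth_manifold_prod:
  assumes A: "smooth_manifold A" and B: "smooth_manifold B"
  shows "smooth_manifold (prod_atlas A B)"
  unfolding smooth_manifold_def
proof (intro conjI ballI)
  fix k assume k: "k \<in> charts (prod_atlas A B)"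
  then have kA: "fst k \<in> charts A" and kB: "snd k \<in> charts B" by auto
  have hA: "homeomorphism (chart_dom A (fst k)) (chart_img A (fst k))
      (chart_map A (fst k)) (chart_inv A (fst k))"
    and hB: "homeomorphism (chart_dom B (snd k)) (chart_img B (snd k))
      (chart_map B (snd k)) (chart_inv B (snd k))"
    and o: "open (chart_dom A (fst k))" "open (chart_dom B (snd k))"
      "open (chart_img A (fst k))" "open (chart_img B (snd k))"
    using A B kA kB by (auto simp: smooth_manifold_def)
  show "open (chart_dom (prod_atlas A B) k)" "open (chart_img (prod_atlas A B) k)"
    using o by (auto simp: open_Times)
  let ?D = "chart_dom A (fst k) \<times> chart_dom B (snd k)"
  let ?I = "chart_img A (fst k) \<times> chart_img B (snd k)"
  let ?inv = "\<lambda>z. (chart_inv A (fst k) (fst z), chart_inv B (snd k) (snd z))"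
  have inv: "chart_inv (prod_atlas A B) k z = ?inv z" if "z \<in> ?I" for z
    using prod_chart_inv[OF A B _ that] k by auto
  have "homeomorphism ?D ?I (chart_map (prod_atlas A B) k) ?inv"
  proof (rule homeomorphismI)
    show "continuous_on ?D (chart_map (prod_atlas A B) k)"
    proof -
      have "continuous_on ?D (\<lambda>z. (chart_map A (fst k) (fst z), chart_map B (snd k) (snd z)))"
        using hA hB
        by (intro continuous_on_Pair continuous_on_compose2[OF homeomorphism_cont1[OF hA]]
            continuous_on_compose2[OF homeomorphism_cont1[OF hB]] continuous_intros) auto
      then show ?thesis by (rule continuous_on_eq) simp
    qed
    show "continuous_on ?I ?inv"
      by (intro continuous_on_Pair continuous_on_compose2[OF homeomorphism_cont2[OF hA]]
          continuous_on_compose2[OF homeomorphism_cont2[OF hB]] continuous_intros) auto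
  qed (use hA hB in \<open>auto simp: chart_img_def homeomorphism_def\<close>)
  then have "homeomorphism ?D ?I (chart_map (prod_atlas A B) k) (chart_inv (prod_atlas A B) k)"
    by (rule homeomorphism_cong) (auto simp: inv)
  then show "homeomorphism (chart_dom (prod_atlas A B) k) (chart_img (prod_atlas A B) k)
      (chart_map (prod_atlas A B) k) (chart_inv (prod_atlas A B) k)"
    by simp
next
  fix k l assume kl: "k \<in> charts (prod_atlas A B)" "l \<in> charts (prod_atlas A B)"
  let ?S = "overlap A (fst k) (fst l)" and ?T = "overlap B (snd k) (snd l)"
  have o: "open ?S" "open ?T" using kl A B by (auto intro!: open_overlap)
  have "smooth_on (?S \<times> ?T)
      (\<lambda>z. (transition A (fst k) (fst l) (fst z), transition B (snd k) (snd l) (snd z)))"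
    using o kl A B by (auto intro!: smooth_on_Pair smooth_transition)
  moreover have "open (?S \<times> ?T)" using o by (simp add: open_Times)
  ultimately show "smooth_on (overlap (prod_atlas A B) k l) (transition (prod_atlas A B) k l)"
    using smooth_on_cong[of "?S \<times> ?T" "transition (prod_atlas A B) k l"]
      transition_prod[OF A B] kl by auto
qed

lemma frechet_derivative_transition_prod:
  assumes A: "smooth_manifold A" and B: "smooth_manifold B"
    and kl: "k \<in> charts A \<times> charts B" "l \<in> charts A \<times> charts B"
    and z: "z \<in> overlap A (fst k) (fst l) \<times> overlap B (snd k) (snd l)"
  shows "frechet_derivative (transition (prod_atlas A B) k l) (at z) v
    = (frechet_derivative (transition A (fst k) (fst l)) (at (fst z)) (fst v),
       frechet_derivative (transition B (snd k) (snd l)) (at (snd z)) (snd v))"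
proof -
  let ?tA = "transition A (fst k) (fst l)" and ?tB = "transition B (snd k) (snd l)"
  let ?S = "overlap A (fst k) (fst l)" and ?T = "overlap B (snd k) (snd l)"
  have o: "open (?S \<times> ?T)" using kl A B by (auto intro!: open_overlap open_Times)
  have dA: "(?tA has_derivative frechet_derivative ?tA (at (fst z))) (at (fst z))"
    by (rule smooth_on_imp_has_derivative[OF smooth_transition[OF A]]) (use kl z in auto)
  have dB: "(?tB has_derivative frechet_derivative ?tB (at (snd z))) (at (snd z))"
    by (rule smooth_on_imp_has_derivative[OF smooth_transition[OF B]]) (use kl z in auto)
  have "((\<lambda>z. (?tA (fst z), ?tB (snd z))) has_derivative
      (\<lambda>v. (frechet_derivative ?tA (at (fst z)) (fst v),
            frechet_derivative ?tB (at (snd z)) (snd v)))) (at z)"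
    by (intro has_derivative_Pair
        has_derivative_compose[OF has_derivative_fst[OF has_derivative_ident] dA]
        has_derivative_compose[OF has_derivative_snd[OF has_derivative_ident] dB])
  then have "(transition (prod_atlas A B) k l has_derivative
      (\<lambda>v. (frechet_derivative ?tA (at (fst z)) (fst v),
            frechet_derivative ?tB (at (snd z)) (snd v)))) (at z)"
    by (rule has_derivative_transform_within_open[OF _ o z])
      (use transition_prod[OF A B kl(1)] in auto)
  from frechet_derivative_at[OF this] show ?thesis by (rule fun_cong[OF sym])
qed

lemma pseudo_riemannian_warped:
  assumes g1: "pseudo_riemannian A g1" and g2: "pseudo_riemannian B g2"
    and f: "smooth_function A f" "\<forall>p\<in>carrier A. f p > 0"
  shows "pseudo_riemannian (prod_atlas A B) (warped_metric A f g1 g2)"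
proof -
  have A: "smooth_manifold A" and B: "smooth_manifold B"
    using g1 g2 by (auto simp: pseudo_riemannian_def)
  let ?g = "warped_metric A f g1 g2"
  have smooth: "smooth_on (chart_img A (fst k) \<times> chart_img B (snd k)) (\<lambda>z. ?g k z v w)"
    if k: "k \<in> charts A \<times> charts B" for k v w
  proof -
    let ?U = "chart_img A (fst k) \<times> chart_img B (snd k)"
    have op: "open ?U" using k A B by (auto intro!: open_Times open_chart_img)
    have "Ck_on n (chart_img A (fst k)) (\<lambda>x. g1 (fst k) x a b)"
      "Ck_on n (chart_img B (snd k)) (\<lambda>y. g2 (snd k) y c d)"
      "Ck_on n (chart_img A (fst k)) (\<lambda>x. f (chart_inv A (fst k) x))" for n a b c d
      using g1 g2 f(1) k by (auto simp: pseudo_riemannian_def smooth_function_def smooth_on_def)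
    note * = this
    have "Ck_on n ?U (\<lambda>z. ?g k z v w)" for n
      unfolding warped_metric_def power2_eq_square
      by (intro Ck_on_add[OF op] Ck_on_mult[OF op] Ck_on_compose_linear[OF op bounded_linear_fst _ *(1)]
          Ck_on_compose_linear[OF op bounded_linear_snd _ *(2)]
          Ck_on_compose_linear[OF op bounded_linear_fst _ *(3)]) auto
    then show ?thesis by (simp add: smooth_on_def)
  qed
  have algebra: "bilinear (?g k z) \<and> (\<forall>v w. ?g k z v w = ?g k z w v)
      \<and> (\<forall>v. (\<forall>w. ?g k z v w = 0) \<longrightarrow> v = 0)"
    if k: "k \<in> charts A \<times> charts B" and z: "z \<in> chart_img A (fst k) \<times> chart_img B (snd k)" for k z
  proof -
    define a where "a = (f (chart_inv A (fst k) (fst z)))\<^sup>2"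
    have "chart_inv A (fst k) (fst z) \<in> carrier A"
      using k z chart_inv_in[of "fst z" A "fst k"] by (auto simp: carrier_def)
    then have "f (chart_inv A (fst k) (fst z)) > 0" using f(2) by blast
    then have a: "a > 0" by (simp add: a_def)
    let ?h1 = "g1 (fst k) (fst z)" and ?h2 = "g2 (snd k) (snd z)"
    have g: "?g k z v w = ?h1 (fst v) (fst w) + a * ?h2 (snd v) (snd w)" for v w
      by (simp add: warped_metric_def a_def)
    have h1: "bilinear ?h1" "\<And>v w. ?h1 v w = ?h1 w v" "\<And>v. (\<forall>w. ?h1 v w = 0) \<Longrightarrow> v = 0"
      and h2: "bilinear ?h2" "\<And>v w. ?h2 v w = ?h2 w v" "\<And>v. (\<forall>w. ?h2 v w = 0) \<Longrightarrow> v = 0"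
      using g1 g2 k z unfolding pseudo_riemannian_def mem_Times_iff by blast+
    note simps = bilinear_ladd[OF h1(1)] bilinear_radd[OF h1(1)] bilinear_lmul[OF h1(1)]
      bilinear_rmul[OF h1(1)] bilinear_lzero[OF h1(1)] bilinear_rzero[OF h1(1)]
      bilinear_ladd[OF h2(1)] bilinear_radd[OF h2(1)] bilinear_lmul[OF h2(1)]
      bilinear_rmul[OF h2(1)] bilinear_lzero[OF h2(1)] bilinear_rzero[OF h2(1)]
    have "bilinear (?g k z)"
      unfolding bilinear_def by (auto intro!: linearI simp: g simps algebra_simps)
    moreover have "?g k z v w = ?g k z w v" for v w
      by (simp add: g h1(2)[of "fst v"] h2(2)[of "snd v"])
    moreover have "v = 0" if v: "\<forall>w. ?g k z v w = 0" for v
    proof -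
      have "?h1 (fst v) w = 0" for w using v[rule_format, of "(w, 0)"] by (simp add: g simps)
      moreover have "?h2 (snd v) w = 0" for w
        using v[rule_format, of "(0, w)"] a by (simp add: g simps)
      ultimately show ?thesis using h1(3) h2(3) by (simp add: prod_eq_iff)
    qed
    ultimately show ?thesis by blast
  qed
  have trans: "?g k z v w = ?g l (transition (prod_atlas A B) k l z)
        (frechet_derivative (transition (prod_atlas A B) k l) (at z) v)
        (frechet_derivative (transition (prod_atlas A B) k l) (at z) w)"
    if kl: "k \<in> charts A \<times> charts B" "l \<in> charts A \<times> charts B"
      and z: "z \<in> overlap A (fst k) (fst l) \<times> overlap B (snd k) (snd l)" for k l z v w
  proof -
    have "chart_inv A (fst l) (transition A (fst k) (fst l) (fst z)) = chart_inv A (fst k) (fst z)"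
      using kl z chart_inv_map[OF A] by (auto simp: overlap_def transition_def)
    moreover have "g1 (fst k) (fst z) (fst v) (fst w) = g1 (fst l) (transition A (fst k) (fst l) (fst z))
        (frechet_derivative (transition A (fst k) (fst l)) (at (fst z)) (fst v))
        (frechet_derivative (transition A (fst k) (fst l)) (at (fst z)) (fst w))"
      using g1 kl z unfolding pseudo_riemannian_def mem_Times_iff by blast
    moreover have "g2 (snd k) (snd z) (snd v) (snd w) = g2 (snd l) (transition B (snd k) (snd l) (snd z))
        (frechet_derivative (transition B (snd k) (snd l)) (at (snd z)) (snd v))
        (frechet_derivative (transition B (snd k) (snd l)) (at (snd z)) (snd w))"
      using g2 kl z unfolding pseudo_riemannian_def mem_Times_iff by blast
    ultimately show ?thesis
      using frechet_derivative_transition_prod[OF A B kl z] transition_prod[OF A B kl(1) z]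
      by (simp add: warped_metric_def)
  qed
  show ?thesis
    unfolding pseudo_riemannian_def prod_atlas_simps
    using smooth_manifold_prod[OF A B] smooth algebra trans by blast
qed

lemma vector_field_lift:
  assumes A: "smooth_manifold A" and B: "smooth_manifold B"
    and X: "vector_field A X" and Y: "vector_field B Y"
  shows "vector_field (prod_atlas A B) (add_vf (lift1 X) (lift2 Y))"
proof -
  have eq: "add_vf (lift1 X) (lift2 Y) = (\<lambda>k z. (X (fst k) (fst z), Y (snd k) (snd z)))"
    by (simp add: add_vf_def lift1_def lift2_def)
  show ?thesis
    unfolding vector_field_def prod_atlas_simps eq
  proof (intro conjI ballI)
    fix k assume "k \<in> charts A \<times> charts B"
    then show "smooth_on (chart_img A (fst k) \<times> chart_img B (snd k))
        (\<lambda>z. (X (fst k) (fst z), Y (snd k) (snd z)))"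
      using A B X Y by (auto intro!: smooth_on_Pair open_chart_img simp: vector_field_def)
  next
    fix k l z
    assume kl: "k \<in> charts A \<times> charts B" "l \<in> charts A \<times> charts B"
      and z: "z \<in> overlap A (fst k) (fst l) \<times> overlap B (snd k) (snd l)"
    have "X (fst l) (transition A (fst k) (fst l) (fst z))
        = frechet_derivative (transition A (fst k) (fst l)) (at (fst z)) (X (fst k) (fst z))"
      "Y (snd l) (transition B (snd k) (snd l) (snd z))
        = frechet_derivative (transition B (snd k) (snd l)) (at (snd z)) (Y (snd k) (snd z))"
      using X Y kl z unfolding vector_field_def mem_Times_iff by blast+
    then show "(X (fst l) (fst (transition (prod_atlas A B) k l z)),
          Y (snd l) (snd (transition (prod_atlas A B) k l z)))
        = frechet_derivative (transition (prod_atlas A B) k l) (at z)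
            (X (fst k) (fst z), Y (snd k) (snd z))"
      using frechet_derivative_transition_prod[OF A B kl z] transition_prod[OF A B kl(1) z]
      by simp
  qed
qed

end

theory Submission
  imports Defs
begin

text \<open>Cases (1), (3) and (4) follow from
  \<open>L\<^sub>\<zeta> g = L\<^bsub>\<zeta>1\<^esub> g\<^sub>1 + \<zeta>\<^sub>1(f\<^sup>2) g\<^sub>2 + f\<^sup>2 L\<^bsub>\<zeta>2\<^esub> g\<^sub>2\<close>. In case (2) this reduces the soliton
  equation to \<open>Ric = \<lambda> g - \<phi> g\<^sub>2\<close> with \<open>2\<phi> = \<zeta>\<^sub>1(f\<^sup>2)\<close>, and the point is that \<open>\<phi> = 0\<close>.
  The contracted Bianchi identity on the warped product forces \<open>\<phi>\<close> to be locally constant. On the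
  other hand, \<open>\<zeta>\<^sub>1\<close> is Killing, so the Ricci curvature of \<open>g\<^sub>1\<close> is invariant under \<open>\<zeta>\<^sub>1\<close>; inserting
  \<open>\<zeta>\<^sub>1\<close> twice into the horizontal part of the soliton equation and differentiating repeatedly along
  \<open>\<zeta>\<^sub>1\<close> yields \<open>\<phi> = 0\<close>. All of this takes place in a single chart.\<close>

section \<open>Directional derivatives of smooth maps\<close>

text \<open>The difficulty is case (2): nothing there controls \<open>f\<close> along
  \<open>\<zeta>1\<close>, and in indefinite signature \<open>\<zeta>1\<close> may be null, so no
  positivity of its length can be exploited. What replaces positivity is a count of powers. Along
  the flow of \<open>\<zeta>1\<close> the function \<open>F = f^2\<close> is affine, because its
  derivative \<open>\<zeta>1(F)\<close> is locally constant, whereas the curvature quantities in the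
  contracted soliton equation do not change at all. That equation is polynomial in \<open>F\<close>,
  so a nonzero slope would force every coefficient to vanish, the square of the slope included.
  Repeated differentiation is this comparison of coefficients carried out at a single point, without
  integrating the flow. A second obstacle is regularity: the connection is given by a definite
  description, so its smoothness has to be extracted from nondegeneracy. This is done through the
  inverse metric, by a resolvent identity and bootstrapping instead of determinants.\<close>

definition pd :: "'a::euclidean_space \<Rightarrow> ('a \<Rightarrow> 'b::real_normed_vector) \<Rightarrow> 'a \<Rightarrow> 'b" where
  "pd v f x = frechet_derivative f (at x) v"

lemma smooth_on_has_derivative:
  "smooth_on S f \<Longrightarrow> x \<in> S \<Longrightarrow> (f has_derivative (\<lambda>v. pd v f x)) (at x)"
  unfolding pd_def by (rule smooth_on_imp_has_derivative)

lemma has_derivative_imp_pd: "(f has_derivative D) (at x) \<Longrightarrow> pd v f x = D v"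
  unfolding pd_def by (metis frechet_derivative_at)

lemma smooth_on_continuous: "smooth_on S f \<Longrightarrow> continuous_on S f"
  unfolding smooth_on_def by (metis Ck_on.simps(1))

lemma smooth_on_pd: "smooth_on S f \<Longrightarrow> smooth_on S (pd v f)"
  unfolding smooth_on_def pd_def using Ck_on_SucE(2) by blast

lemma linear_pd: "smooth_on S f \<Longrightarrow> x \<in> S \<Longrightarrow> linear (\<lambda>v. pd v f x)"
  using smooth_on_has_derivative has_derivative_linear by blast

text \<open>\<open>frechet_derivative\<close> selects a derivative by choice, and the set of
  candidates depends only on the germ at \<open>x\<close>. So even the value at a point of
  non-differentiability is the same for both functions.\<close>

lemma pd_cong:
  assumes "open S" "x \<in> S" "\<And>y. y \<in> S \<Longrightarrow> f y = g y"
  shows "pd v f x = pd v g x"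
proof -
  have "(f has_derivative D) (at x) \<longleftrightarrow> (g has_derivative D) (at x)" for D
    using assms has_derivative_transform_within_open[of f D x UNIV S g]
      has_derivative_transform_within_open[of g D x UNIV S f] by auto
  then show ?thesis by (simp add: pd_def frechet_derivative_def)
qed

lemma smooth_on_const: "open S \<Longrightarrow> smooth_on S (\<lambda>x. a)"
  by (simp add: smooth_on_def Ck_on_const)

lemma smooth_on_add:
  "open S \<Longrightarrow> smooth_on S f \<Longrightarrow> smooth_on S g \<Longrightarrow> smooth_on S (\<lambda>x. f x + g x)"
  by (simp add: smooth_on_def Ck_on_add)

lemma smooth_on_mult:
  fixes f g :: "'a::euclidean_space \<Rightarrow> real"
  shows "open S \<Longrightarrow> smooth_on S f \<Longrightarrow> smooth_on S g \<Longrightarrow> smooth_on S (\<lambda>x. f x * g x)"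
  by (simp add: smooth_on_def Ck_on_mult)

lemma smooth_on_linear_image:
  "open S \<Longrightarrow> bounded_linear L \<Longrightarrow> smooth_on S f \<Longrightarrow> smooth_on S (\<lambda>x. L (f x))"
  by (simp add: smooth_on_def Ck_on_linear_image)

lemma smooth_on_minus: "open S \<Longrightarrow> smooth_on S f \<Longrightarrow> smooth_on S (\<lambda>x. - f x)"
  by (rule smooth_on_linear_image[OF _ bounded_linear_minus[OF bounded_linear_ident]])

lemma smooth_on_diff:
  "open S \<Longrightarrow> smooth_on S f \<Longrightarrow> smooth_on S g \<Longrightarrow> smooth_on S (\<lambda>x. f x - g x)"
  using smooth_on_add[of S f "\<lambda>x. - g x"] smooth_on_minus[of S g] by simp

lemma smooth_on_sum:
  "open S \<Longrightarrow> (\<And>i. i \<in> I \<Longrightarrow> smooth_on S (f i)) \<Longrightarrow> smooth_on S (\<lambda>x. \<Sum>i\<in>I. f i x)"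
  by (induction I rule: infinite_finite_induct) (auto intro!: smooth_on_const smooth_on_add)

lemma smooth_on_scaleR:
  fixes g :: "'a::euclidean_space \<Rightarrow> 'b::euclidean_space"
  assumes "open S" "smooth_on S f" "smooth_on S g"
  shows "smooth_on S (\<lambda>x. f x *\<^sub>R g x)"
proof -
  have "(\<lambda>x. f x *\<^sub>R g x) = (\<lambda>x. \<Sum>b\<in>Basis. (f x * (g x \<bullet> b)) *\<^sub>R b)"
    by (simp add: euclidean_representation flip: scaleR_scaleR scaleR_sum_right)
  moreover have "smooth_on S (\<lambda>x. (f x * (g x \<bullet> b)) *\<^sub>R b)" for b
    by (rule smooth_on_linear_image[OF assms(1) bounded_linear_scaleR_left])
      (intro smooth_on_mult smooth_on_linear_image[OF _ bounded_linear_inner_left] assms)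
  then have "smooth_on S (\<lambda>x. \<Sum>b\<in>Basis. (f x * (g x \<bullet> b)) *\<^sub>R b)"
    by (intro smooth_on_sum assms(1))
  ultimately show ?thesis by simp
qed

text \<open>The derivative of \<open>inverse f\<close> contains \<open>inverse f\<close> only
  undifferentiated, so order \<open>k\<close> of the inverse gives order
  \<open>k + 1\<close>.\<close>

lemma smooth_on_inverse:
  fixes f :: "'a::euclidean_space \<Rightarrow> real"
  assumes S: "open S" and f: "smooth_on S f" and nz: "\<And>x. x \<in> S \<Longrightarrow> f x \<noteq> 0"
  shows "smooth_on S (\<lambda>x. inverse (f x))"
  unfolding smooth_on_def
proof
  fix k show "Ck_on k S (\<lambda>x. inverse (f x))"
  proof (induction k)
    case 0
    then show ?case using smooth_on_continuous[OF f] nz by (auto intro: continuous_on_inverse)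
  next
    case (Suc k)
    have "Ck_on k S (\<lambda>x. (inverse (f x) * pd v f x * inverse (f x)) * (- 1))" for v
      using smooth_on_pd[OF f] Suc unfolding smooth_on_def
      by (intro Ck_on_mult[OF S] Ck_on_const[OF S]) auto
    then show ?case
      by (intro Ck_on_SucI[OF S, where F = "\<lambda>x v. - (inverse (f x) * pd v f x * inverse (f x))"]
          Deriv.has_derivative_inverse nz smooth_on_has_derivative[OF f]) auto
  qed
qed

lemma smooth_on_ln:
  fixes f :: "'a::euclidean_space \<Rightarrow> real"
  assumes S: "open S" and f: "smooth_on S f" and pos: "\<And>x. x \<in> S \<Longrightarrow> f x > 0"
  shows "smooth_on S (\<lambda>x. ln (f x))"
  unfolding smooth_on_def
proof
  fix k
  have "Ck_on k S (\<lambda>x. pd v f x * inverse (f x))" for v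
    using smooth_on_mult[OF S smooth_on_pd[OF f] smooth_on_inverse[OF S f]] pos
    unfolding smooth_on_def by (metis less_irrefl)
  then have "Ck_on (Suc k) S (\<lambda>x. ln (f x))"
    by (intro Ck_on_SucI[OF S, where F = "\<lambda>x v. pd v f x * inverse (f x)"])
      (auto intro!: has_derivative_eq_rhs[OF has_derivative_ln[OF pos smooth_on_has_derivative[OF f]]]
        simp: divide_inverse)
  then show "Ck_on k S (\<lambda>x. ln (f x))" by (rule Ck_on_SucD)
qed

lemma pd_const: "pd v (\<lambda>x. a) x = 0"
  by (rule has_derivative_imp_pd) (rule has_derivative_const)

lemma pd_add:
  "smooth_on S f \<Longrightarrow> smooth_on S g \<Longrightarrow> x \<in> S \<Longrightarrow> pd v (\<lambda>x. f x + g x) x = pd v f x + pd v g x"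
  by (rule has_derivative_imp_pd) (intro has_derivative_add smooth_on_has_derivative)

lemma pd_diff:
  "smooth_on S f \<Longrightarrow> smooth_on S g \<Longrightarrow> x \<in> S \<Longrightarrow> pd v (\<lambda>x. f x - g x) x = pd v f x - pd v g x"
  by (rule has_derivative_imp_pd) (intro has_derivative_diff smooth_on_has_derivative)

lemma pd_sum:
  "(\<And>i. i \<in> I \<Longrightarrow> smooth_on S (f i)) \<Longrightarrow> x \<in> S \<Longrightarrow>
    pd v (\<lambda>x. \<Sum>i\<in>I. f i x) x = (\<Sum>i\<in>I. pd v (f i) x)"
  by (rule has_derivative_imp_pd) (intro has_derivative_sum smooth_on_has_derivative)

lemma pd_linear_image:
  "bounded_linear L \<Longrightarrow> smooth_on S f \<Longrightarrow> x \<in> S \<Longrightarrow> pd v (\<lambda>x. L (f x)) x = L (pd v f x)"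
  by (rule has_derivative_imp_pd) (rule bounded_linear.has_derivative[OF _ smooth_on_has_derivative])

lemma pd_mult:
  fixes f g :: "'a::euclidean_space \<Rightarrow> real"
  shows "smooth_on S f \<Longrightarrow> smooth_on S g \<Longrightarrow> x \<in> S \<Longrightarrow>
    pd v (\<lambda>x. f x * g x) x = f x * pd v g x + pd v f x * g x"
  by (rule has_derivative_imp_pd) (intro has_derivative_mult smooth_on_has_derivative)

lemma pd_scaleR:
  "smooth_on S f \<Longrightarrow> smooth_on S g \<Longrightarrow> x \<in> S \<Longrightarrow>
    pd v (\<lambda>x. f x *\<^sub>R g x) x = f x *\<^sub>R pd v g x + pd v f x *\<^sub>R g x"
  by (rule has_derivative_imp_pd) (intro has_derivative_scaleR smooth_on_has_derivative)

lemma pd_compose_linear: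
  "bounded_linear L \<Longrightarrow> smooth_on S f \<Longrightarrow> L x \<in> S \<Longrightarrow> pd v (\<lambda>x. f (L x)) x = pd (L v) f (L x)"
  by (rule has_derivative_imp_pd)
    (rule has_derivative_compose[OF bounded_linear_imp_has_derivative smooth_on_has_derivative])

section \<open>Tensor families evaluated on varying vectors\<close>

lemma linear_expand:
  fixes L :: "'a::euclidean_space \<Rightarrow> 'b::real_vector"
  assumes "linear L"
  shows "L v = (\<Sum>b\<in>Basis. (v \<bullet> b) *\<^sub>R L b)"
proof -
  have "L v = L (\<Sum>b\<in>Basis. (v \<bullet> b) *\<^sub>R b)" by (simp add: euclidean_representation)
  also have "\<dots> = (\<Sum>b\<in>Basis. (v \<bullet> b) *\<^sub>R L b)"
    using assms by (simp add: linear_sum linear_cmul)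
  finally show ?thesis .
qed

lemma smooth_on_linear_family:
  fixes B :: "'a::euclidean_space \<Rightarrow> 'b::euclidean_space \<Rightarrow> 'c::euclidean_space"
  assumes S: "open S" and lin: "\<And>x. x \<in> S \<Longrightarrow> linear (B x)"
    and B: "\<And>v. smooth_on S (\<lambda>x. B x v)" and X: "smooth_on S X"
  shows "smooth_on S (\<lambda>x. B x (X x))"
proof -
  have "smooth_on S (\<lambda>x. \<Sum>b\<in>Basis. (X x \<bullet> b) *\<^sub>R B x b)"
    by (intro smooth_on_sum smooth_on_scaleR smooth_on_linear_image[OF _ bounded_linear_inner_left] S B X)
  then show ?thesis
    by (rule smooth_on_cong[OF S, THEN iffD1, rotated]) (rule linear_expand[OF lin, symmetric])
qed

text \<open>Leibniz rule for a tensor applied to a varying vector; in the first term the vector is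
  frozen at \<open>X x\<close>. Expansion in the basis reduces it to the product rule for
  components.\<close>

lemma pd_linear_family:
  fixes B :: "'a::euclidean_space \<Rightarrow> 'b::euclidean_space \<Rightarrow> 'c::euclidean_space"
  assumes S: "open S" and lin: "\<And>x. x \<in> S \<Longrightarrow> linear (B x)"
    and B: "\<And>v. smooth_on S (\<lambda>x. B x v)" and X: "smooth_on S X" and x: "x \<in> S"
  shows "pd v (\<lambda>x. B x (X x)) x = pd v (\<lambda>y. B y (X x)) x + B x (pd v X x)"
proof -
  note sm = smooth_on_linear_image[OF S bounded_linear_inner_left X]
  have "pd v (\<lambda>x. B x (X x)) x = pd v (\<lambda>x. \<Sum>b\<in>Basis. (X x \<bullet> b) *\<^sub>R B x b) x"
    by (rule pd_cong[OF S x]) (rule linear_expand[OF lin])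
  also have "\<dots> = (\<Sum>b\<in>Basis. pd v (\<lambda>x. (X x \<bullet> b) *\<^sub>R B x b) x)"
    by (rule pd_sum[OF _ x]) (intro smooth_on_scaleR S sm B)
  also have "\<dots> = (\<Sum>b\<in>Basis. (X x \<bullet> b) *\<^sub>R pd v (\<lambda>y. B y b) x) + (\<Sum>b\<in>Basis. (pd v X x \<bullet> b) *\<^sub>R B x b)"
    by (simp add: pd_scaleR[OF sm B x] pd_linear_image[OF bounded_linear_inner_left X x] sum.distrib)
  also have "(\<Sum>b\<in>Basis. (X x \<bullet> b) *\<^sub>R pd v (\<lambda>y. B y b) x)
      = pd v (\<lambda>y. \<Sum>b\<in>Basis. (X x \<bullet> b) *\<^sub>R B y b) x"
    by (subst pd_sum[OF _ x])
      (auto intro!: smooth_on_linear_image[OF S bounded_linear_scaleR_right B] sum.cong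
        simp: pd_linear_image[OF bounded_linear_scaleR_right B x])
  also have "\<dots> = pd v (\<lambda>y. B y (X x)) x"
    by (rule pd_cong[OF S x]) (rule linear_expand[OF lin, symmetric])
  also have "(\<Sum>b\<in>Basis. (pd v X x \<bullet> b) *\<^sub>R B x b) = B x (pd v X x)"
    by (rule linear_expand[OF lin[OF x], symmetric])
  finally show ?thesis .
qed

lemma linear_pd_param:
  fixes B :: "'a::euclidean_space \<Rightarrow> 'b::real_vector \<Rightarrow> 'c::real_normed_vector"
  assumes S: "open S" and lin: "\<And>x. x \<in> S \<Longrightarrow> linear (B x)"
    and B: "\<And>v. smooth_on S (\<lambda>x. B x v)" and x: "x \<in> S"
  shows "linear (\<lambda>v. pd p (\<lambda>y. B y v) x)"
proof (rule linearI)
  show "pd p (\<lambda>y. B y (v + w)) x = pd p (\<lambda>y. B y v) x + pd p (\<lambda>y. B y w) x" for v w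
    unfolding pd_add[OF B B x, symmetric]
    by (rule pd_cong[OF S x]) (simp add: linear_add[OF lin])
  show "pd p (\<lambda>y. B y (c *\<^sub>R v)) x = c *\<^sub>R pd p (\<lambda>y. B y v) x" for c v
    unfolding pd_linear_image[OF bounded_linear_scaleR_right B x, symmetric]
    by (rule pd_cong[OF S x]) (simp add: linear_cmul[OF lin])
qed

lemma smooth_on_bilinear_family:
  fixes B :: "'a::euclidean_space \<Rightarrow> 'b::euclidean_space \<Rightarrow> 'c::euclidean_space \<Rightarrow> 'd::euclidean_space"
  assumes S: "open S" and bil: "\<And>x. x \<in> S \<Longrightarrow> bilinear (B x)"
    and B: "\<And>v w. smooth_on S (\<lambda>x. B x v w)" and X: "smooth_on S X" and Y: "smooth_on S Y"
  shows "smooth_on S (\<lambda>x. B x (X x) (Y x))"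
  using bil unfolding bilinear_def
  by (intro smooth_on_linear_family[OF S _ _ Y, of "\<lambda>x. B x (X x)"]
      smooth_on_linear_family[OF S _ B X]) auto

lemma pd_bilinear_family:
  fixes B :: "'a::euclidean_space \<Rightarrow> 'b::euclidean_space \<Rightarrow> 'c::euclidean_space \<Rightarrow> 'd::euclidean_space"
  assumes S: "open S" and bil: "\<And>x. x \<in> S \<Longrightarrow> bilinear (B x)"
    and B: "\<And>v w. smooth_on S (\<lambda>x. B x v w)" and X: "smooth_on S X" and Y: "smooth_on S Y"
    and x: "x \<in> S"
  shows "pd v (\<lambda>x. B x (X x) (Y x)) x
    = pd v (\<lambda>y. B y (X x) (Y x)) x + B x (pd v X x) (Y x) + B x (X x) (pd v Y x)"
proof -
  have lin: "linear (B y u)" "linear (\<lambda>u. B y u w)" if "y \<in> S" for y u w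
    using bil[OF that] by (auto simp: bilinear_def)
  have "pd v (\<lambda>x. B x (X x) (Y x)) x
      = pd v (\<lambda>y. B y (X y) (Y x)) x + B x (X x) (pd v Y x)"
    by (rule pd_linear_family[OF S _ _ Y x, of "\<lambda>x. B x (X x)"])
      (auto intro: lin smooth_on_linear_family[OF S _ B X])
  also have "pd v (\<lambda>y. B y (X y) (Y x)) x
      = pd v (\<lambda>y. B y (X x) (Y x)) x + B x (pd v X x) (Y x)"
    by (rule pd_linear_family[OF S _ B X x]) (rule lin)
  finally show ?thesis .
qed

lemma smooth_on_pd_along:
  fixes f :: "'a::euclidean_space \<Rightarrow> 'b::euclidean_space"
  shows "open S \<Longrightarrow> smooth_on S f \<Longrightarrow> smooth_on S X \<Longrightarrow> smooth_on S (\<lambda>x. pd (X x) f x)"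
  by (rule smooth_on_linear_family[of S "\<lambda>x v. pd v f x"]) (auto intro: linear_pd smooth_on_pd)

lemma pd_pd_along:
  fixes f :: "'a::euclidean_space \<Rightarrow> 'b::euclidean_space"
  shows "open S \<Longrightarrow> smooth_on S f \<Longrightarrow> smooth_on S X \<Longrightarrow> x \<in> S \<Longrightarrow>
    pd v (\<lambda>x. pd (X x) f x) x = pd v (pd (X x) f) x + pd (pd v X x) f x"
  using pd_linear_family[of S "\<lambda>x v. pd v f x" X x v]
  by (auto intro: linear_pd smooth_on_pd)


section \<open>Symmetry of second derivatives\<close>

lemma has_real_derivative_along_line:
  fixes g :: "'a::euclidean_space \<Rightarrow> real"
  assumes "smooth_on S g" "p + s *\<^sub>R v \<in> S"
  shows "((\<lambda>s. g (p + s *\<^sub>R v)) has_real_derivative pd v g (p + s *\<^sub>R v)) (at s)"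
proof -
  have "((\<lambda>s. p + s *\<^sub>R v) has_derivative (\<lambda>h. h *\<^sub>R v)) (at s)"
    by (auto intro!: derivative_eq_intros)
  from has_derivative_compose[OF this smooth_on_has_derivative[OF assms]]
  show ?thesis
    using linear_cmul[OF linear_pd[OF assms]]
    by (auto simp: has_field_derivative_def mult.commute[of "pd v g (p + s *\<^sub>R v)"]
        elim!: has_derivative_eq_rhs)
qed

text \<open>The mean value theorem is applied twice, along \<open>u\<close> to the increment in
  direction \<open>v\<close>, then along \<open>v\<close>. The second difference is symmetric in
  \<open>u\<close> and \<open>v\<close>, the mixed derivative on the right a priori is not.\<close>

lemma second_difference_mean_value:
  fixes f :: "'a::euclidean_space \<Rightarrow> real"
  assumes f: "smooth_on S f" and t: "0 < t"
    and S: "\<And>a b. 0 \<le> a \<Longrightarrow> a \<le> t \<Longrightarrow> 0 \<le> b \<Longrightarrow> b \<le> t \<Longrightarrow> x + a *\<^sub>R u + b *\<^sub>R v \<in> S"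
  obtains a b where "0 < a" "a < t" "0 < b" "b < t"
    "f (x + t *\<^sub>R u + t *\<^sub>R v) - f (x + t *\<^sub>R u) - f (x + t *\<^sub>R v) + f x
      = t * (t * pd v (pd u f) (x + a *\<^sub>R u + b *\<^sub>R v))"
proof -
  let ?h = "\<lambda>s. f ((x + t *\<^sub>R v) + s *\<^sub>R u) - f (x + s *\<^sub>R u)"
  have "(?h has_real_derivative pd u f ((x + t *\<^sub>R v) + s *\<^sub>R u) - pd u f (x + s *\<^sub>R u)) (at s)"
    if "0 \<le> s" "s \<le> t" for s
    using S[of s t] S[of s 0] that t
    by (intro DERIV_diff has_real_derivative_along_line[OF f]) (simp_all add: algebra_simps)
  from MVT2[OF t this] obtain a where a: "0 < a" "a < t"
    "?h t - ?h 0 = (t - 0) * (pd u f ((x + t *\<^sub>R v) + a *\<^sub>R u) - pd u f (x + a *\<^sub>R u))"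
    by blast
  have "((\<lambda>s. pd u f ((x + a *\<^sub>R u) + s *\<^sub>R v)) has_real_derivative
      pd v (pd u f) ((x + a *\<^sub>R u) + s *\<^sub>R v)) (at s)" if "0 \<le> s" "s \<le> t" for s
    using S[of a s] that a by (intro has_real_derivative_along_line[OF smooth_on_pd[OF f]]) simp
  from MVT2[OF t this] obtain b where b: "0 < b" "b < t"
    "pd u f ((x + a *\<^sub>R u) + t *\<^sub>R v) - pd u f ((x + a *\<^sub>R u) + 0 *\<^sub>R v)
      = (t - 0) * pd v (pd u f) ((x + a *\<^sub>R u) + b *\<^sub>R v)"
    by blast
  show ?thesis
    by (rule that[OF a(1,2) b(1,2)]) (use a(3) b(3) in \<open>simp add: algebra_simps\<close>)
qed

text \<open>Evaluating the symmetric second difference in both orders gives equal mixed derivatives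
  at two points arbitrarily close to \<open>x\<close>; continuity does the rest.\<close>

lemma pd_commute_real:
  fixes f :: "'a::euclidean_space \<Rightarrow> real"
  assumes S: "open S" and f: "smooth_on S f" and x: "x \<in> S"
  shows "pd u (pd v f) x = pd v (pd u f) x"
proof (rule ccontr)
  assume neq: "\<not> ?thesis"
  define e where "e = \<bar>pd u (pd v f) x - pd v (pd u f) x\<bar> / 2"
  have e: "e > 0" using neq by (simp add: e_def)
  have cont: "isCont (pd u (pd v f)) x" "isCont (pd v (pd u f)) x"
    using smooth_on_continuous[OF smooth_on_pd[OF smooth_on_pd[OF f]]] S x
    by (simp_all add: continuous_on_eq_continuous_at)
  obtain d1 where d1: "d1 > 0" "\<And>y. dist y x < d1 \<Longrightarrow> dist (pd u (pd v f) y) (pd u (pd v f) x) < e"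
    using cont(1) e unfolding continuous_at_eps_delta by blast
  obtain d2 where d2: "d2 > 0" "\<And>y. dist y x < d2 \<Longrightarrow> dist (pd v (pd u f) y) (pd v (pd u f) x) < e"
    using cont(2) e unfolding continuous_at_eps_delta by blast
  obtain d3 where d3: "d3 > 0" "\<And>y. dist y x < d3 \<Longrightarrow> y \<in> S"
    using S x unfolding open_dist by blast
  define d where "d = min d1 (min d2 d3)"
  \<comment> \<open>The parallelogram with sides \<open>t u\<close> and \<open>t v\<close> stays in
    the ball of radius \<open>d\<close>; the summand 1 keeps the denominator positive when both
    vectors vanish.\<close>
  define t where "t = d / (norm u + norm v + 1)"
  have pos: "norm u + norm v + 1 > 0" using norm_ge_zero[of u] norm_ge_zero[of v] by linarith
  have d: "d > 0" using d1 d2 d3 by (simp add: d_def)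
  then have t: "t > 0" using pos by (simp add: t_def)
  have near: "dist (x + a *\<^sub>R u + b *\<^sub>R v) x < d" "dist (x + a *\<^sub>R v + b *\<^sub>R u) x < d"
    if "0 \<le> a" "a \<le> t" "0 \<le> b" "b \<le> t" for a b
  proof -
    have *: "norm (a *\<^sub>R p + b *\<^sub>R q) < d" if "norm p + norm q = norm u + norm v" for p q :: 'a
    proof -
      have "norm (a *\<^sub>R p + b *\<^sub>R q) \<le> a * norm p + b * norm q"
        using norm_triangle_ineq[of "a *\<^sub>R p" "b *\<^sub>R q"] \<open>0 \<le> a\<close> \<open>0 \<le> b\<close> by simp
      also have "\<dots> \<le> t * norm p + t * norm q"
        using \<open>a \<le> t\<close> \<open>b \<le> t\<close> by (intro add_mono mult_right_mono) auto
      also have "\<dots> = t * (norm u + norm v)" by (simp add: that flip: distrib_left)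
      also have "\<dots> < t * (norm u + norm v + 1)" using t by simp
      also have "\<dots> = d" using pos by (simp add: t_def)
      finally show ?thesis .
    qed
    show "dist (x + a *\<^sub>R u + b *\<^sub>R v) x < d" "dist (x + a *\<^sub>R v + b *\<^sub>R u) x < d"
      using *[of u v] *[of v u] by (simp_all add: dist_norm add.assoc)
  qed
  have inS: "x + a *\<^sub>R u + b *\<^sub>R v \<in> S" "x + a *\<^sub>R v + b *\<^sub>R u \<in> S"
    if "0 \<le> a" "a \<le> t" "0 \<le> b" "b \<le> t" for a b
    using near[OF that] d3(2) by (simp_all add: d_def)
  obtain a b where ab: "0 < a" "a < t" "0 < b" "b < t"
    "f (x + t *\<^sub>R u + t *\<^sub>R v) - f (x + t *\<^sub>R u) - f (x + t *\<^sub>R v) + f x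
      = t * (t * pd v (pd u f) (x + a *\<^sub>R u + b *\<^sub>R v))"
    using second_difference_mean_value[OF f t inS(1)] by blast
  obtain a' b' where ab': "0 < a'" "a' < t" "0 < b'" "b' < t"
    "f (x + t *\<^sub>R v + t *\<^sub>R u) - f (x + t *\<^sub>R v) - f (x + t *\<^sub>R u) + f x
      = t * (t * pd u (pd v f) (x + a' *\<^sub>R v + b' *\<^sub>R u))"
    using second_difference_mean_value[OF f t inS(2)] by blast
  have "x + t *\<^sub>R v + t *\<^sub>R u = x + t *\<^sub>R u + t *\<^sub>R v" by simp
  from ab(5) ab'(5)[unfolded this] have "t * (t * pd v (pd u f) (x + a *\<^sub>R u + b *\<^sub>R v))
      = t * (t * pd u (pd v f) (x + a' *\<^sub>R v + b' *\<^sub>R u))" by linarith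
  then have eq: "pd v (pd u f) (x + a *\<^sub>R u + b *\<^sub>R v) = pd u (pd v f) (x + a' *\<^sub>R v + b' *\<^sub>R u)"
    using t by simp
  have "dist (pd v (pd u f) (x + a *\<^sub>R u + b *\<^sub>R v)) (pd v (pd u f) x) < e"
    using near(1)[of a b] ab by (intro d2(2)) (simp add: d_def)
  moreover have "dist (pd u (pd v f) (x + a' *\<^sub>R v + b' *\<^sub>R u)) (pd u (pd v f) x) < e"
    using near(2)[of a' b'] ab' by (intro d1(2)) (simp add: d_def)
  ultimately have "\<bar>pd u (pd v f) x - pd v (pd u f) x\<bar> < 2 * e"
    unfolding eq dist_real_def by linarith
  then show False by (simp add: e_def)
qed

lemma pd_commute:
  fixes f :: "'a::euclidean_space \<Rightarrow> 'b::euclidean_space"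
  assumes S: "open S" and f: "smooth_on S f" and x: "x \<in> S"
  shows "pd u (pd v f) x = pd v (pd u f) x"
proof (rule euclidean_eqI)
  fix b :: 'b
  let ?f = "\<lambda>x. f x \<bullet> b"
  have sm: "smooth_on S ?f" by (rule smooth_on_linear_image[OF S bounded_linear_inner_left f])
  have 1: "pd v ?f y = pd v f y \<bullet> b" if "y \<in> S" for v y
    by (rule pd_linear_image[OF bounded_linear_inner_left f that])
  have 2: "pd u (pd v ?f) x = pd u (pd v f) x \<bullet> b" for u v
    using pd_cong[OF S x 1[of _ v], where v = u]
      pd_linear_image[OF bounded_linear_inner_left smooth_on_pd[OF f, of v] x, where v = u] by simp
  show "pd u (pd v f) x \<bullet> b = pd v (pd u f) x \<bullet> b"
    using pd_commute_real[OF S sm x, of u v] by (simp add: 2)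
qed

section \<open>Levi-Civita connection and curvature in a chart\<close>

text \<open>As \<open>h x = 0\<close>, the increment of the product is
  \<open>q y * (h y - h x)\<close>, and continuity of \<open>q\<close> suffices. This permits
  differentiating the inverse metric before it is known to be differentiable.\<close>

lemma has_derivative_mult_vanishing:
  fixes q h :: "'a::real_normed_vector \<Rightarrow> real"
  assumes q: "isCont q x" and h: "(h has_derivative h') (at x)" and 0: "h x = 0"
  shows "((\<lambda>y. q y * h y) has_derivative (\<lambda>v. q x * h' v)) (at x)"
  unfolding has_derivative_iff_norm
proof
  have bl: "bounded_linear h'" using h by (rule has_derivative_bounded_linear)
  then show "bounded_linear (\<lambda>v. q x * h' v)" by (rule bounded_linear_const_mult)
  obtain K where K: "\<And>v. norm (h' v) \<le> norm v * K" using bounded_linear.bounded[OF bl] by blast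
  let ?N = "\<lambda>y. norm (h y - h x - h' (y - x)) / norm (y - x)"
  have N: "(?N \<longlongrightarrow> 0) (at x)" using h by (simp add: has_derivative_iff_norm)
  have qx: "(q \<longlongrightarrow> q x) (at x)" using q by (simp add: isCont_def)
  have "((\<lambda>y. \<bar>q y\<bar> * ?N y + \<bar>q y - q x\<bar> * K) \<longlongrightarrow> \<bar>q x\<bar> * 0 + \<bar>q x - q x\<bar> * K) (at x)"
    by (intro tendsto_intros N qx)
  then have lim: "((\<lambda>y. \<bar>q y\<bar> * ?N y + \<bar>q y - q x\<bar> * K) \<longlongrightarrow> 0) (at x)" by simp
  show "((\<lambda>y. norm (q y * h y - q x * h x - q x * h' (y - x)) / norm (y - x)) \<longlongrightarrow> 0) (at x)"
  proof (rule Lim_null_comparison[OF _ lim])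
    have "norm (q y * h y - q x * h x - q x * h' (y - x)) / norm (y - x)
        \<le> \<bar>q y\<bar> * ?N y + \<bar>q y - q x\<bar> * K" if "y \<noteq> x" for y
    proof -
      have "q y * h y - q x * h x - q x * h' (y - x) = q y * (h y - h x - h' (y - x)) + (q y - q x) * h' (y - x)"
        by (simp add: 0 algebra_simps)
      then have "norm (q y * h y - q x * h x - q x * h' (y - x))
          \<le> \<bar>q y\<bar> * norm (h y - h x - h' (y - x)) + \<bar>q y - q x\<bar> * norm (h' (y - x))"
        using norm_triangle_ineq by (metis norm_mult real_norm_def)
      also have "\<dots> \<le> \<bar>q y\<bar> * norm (h y - h x - h' (y - x)) + \<bar>q y - q x\<bar> * (norm (y - x) * K)"
        by (intro add_left_mono mult_left_mono K) auto
      also have "\<dots> = (\<bar>q y\<bar> * ?N y + \<bar>q y - q x\<bar> * K) * norm (y - x)"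
        using that by (simp add: field_simps)
      finally show ?thesis using that by (simp add: divide_le_eq)
    qed
    then show "\<forall>\<^sub>F y in at x. norm (norm (q y * h y - q x * h x - q x * h' (y - x)) / norm (y - x))
        \<le> \<bar>q y\<bar> * ?N y + \<bar>q y - q x\<bar> * K"
      by (auto simp: eventually_at_filter intro!: always_eventually)
  qed
qed

text \<open>Cyclicity of the trace. In traces of curvature identities it cancels the term acting on
  the value of the curvature against the one acting in the traced slot.\<close>

lemma sum_trace_commute:
  fixes J L :: "'a::euclidean_space \<Rightarrow> 'a"
  assumes J: "linear J" and L: "linear L"
  shows "(\<Sum>b\<in>Basis. J (L b) \<bullet> b) = (\<Sum>b\<in>Basis. L (J b) \<bullet> b)"
proof -
  have "J (L b) \<bullet> b = (\<Sum>c\<in>Basis. (L b \<bullet> c) * (J c \<bullet> b))" for b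
    by (subst linear_expand[OF J]) (simp add: inner_sum_left)
  moreover have "L (J b) \<bullet> b = (\<Sum>c\<in>Basis. (J b \<bullet> c) * (L c \<bullet> b))" for b
    by (subst linear_expand[OF L]) (simp add: inner_sum_left)
  ultimately show ?thesis
    using sum.swap[of "\<lambda>b c. (L b \<bullet> c) * (J c \<bullet> b)" Basis Basis] by (simp add: mult.commute)
qed

section \<open>Metrics on an open set and the inverse metric\<close>

locale local_metric =
  fixes S :: "'a::euclidean_space set" and G :: "'a \<Rightarrow> 'a \<Rightarrow> 'a \<Rightarrow> real"
  assumes open_S: "open S"
    and smooth: "smooth_on S (\<lambda>x. G x v w)"
    and bilin: "x \<in> S \<Longrightarrow> bilinear (G x)"
    and sym: "x \<in> S \<Longrightarrow> G x v w = G x w v"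
    and nondeg: "x \<in> S \<Longrightarrow> (\<And>w. G x v w = 0) \<Longrightarrow> v = 0"
begin

lemma linear_G: "x \<in> S \<Longrightarrow> linear (G x v)" "x \<in> S \<Longrightarrow> linear (\<lambda>v. G x v w)"
  using bilin by (auto simp: bilinear_def)

lemmas G_simps = linear_add[OF linear_G(1)] linear_add[OF linear_G(2)]
  linear_diff[OF linear_G(1)] linear_diff[OF linear_G(2)]
  linear_cmul[OF linear_G(1)] linear_cmul[OF linear_G(2)]
  linear_neg[OF linear_G(1)] linear_neg[OF linear_G(2)]
  linear_0[OF linear_G(1)] linear_0[OF linear_G(2)]

lemma G_cancel: "x \<in> S \<Longrightarrow> (\<And>w. G x u w = G x v w) \<Longrightarrow> u = v"
  using nondeg[of x "u - v"] by (simp add: G_simps)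

text \<open>Nondegeneracy makes the coordinate form \<open>?T\<close> of the metric injective, hence
  surjective in finite dimension.\<close>

lemma G_represents:
  assumes x: "x \<in> S" and \<phi>: "linear \<phi>"
  shows "\<exists>!u. \<forall>z. G x u z = \<phi> z"
proof -
  let ?T = "\<lambda>w. \<Sum>b\<in>Basis. G x w b *\<^sub>R b"
  have T: "linear ?T"
    by (intro linearI) (simp_all add: G_simps[OF x] scaleR_left_distrib sum.distrib scaleR_sum_right)
  have Tb: "?T w \<bullet> b = G x w b" if "b \<in> Basis" for w b
    using that by simp
  have "v = 0" if v: "?T v = 0" for v
  proof (rule nondeg[OF x])
    have "G x v b = 0" if "b \<in> Basis" for b using Tb[OF that, of v] v by simp
    then show "G x v w = 0" for w by (subst linear_expand[OF linear_G(1)[OF x]]) simp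
  qed
  then have "inj ?T" using linear_injective_0[OF T] by blast
  then have "surj ?T" by (rule linear_injective_imp_surjective[OF T]) simp
  from surjD[OF this, of "\<Sum>b\<in>Basis. \<phi> b *\<^sub>R b"]
  obtain u where u: "(\<Sum>b\<in>Basis. \<phi> b *\<^sub>R b) = ?T u" by blast
  have "G x u b = \<phi> b" if "b \<in> Basis" for b
    using Tb[OF that, of u] that unfolding u[symmetric] by simp
  then have "G x u z = \<phi> z" for z
    unfolding linear_expand[OF linear_G(1)[OF x], of u z] linear_expand[OF \<phi>, of z] by simp
  then show ?thesis by (intro ex1I[of _ u] G_cancel[OF x]) simp_all
qed

text \<open>For \<open>b\<close> in the basis these are the rows of the inverse matrix of
  \<open>G x\<close>. Metric traces are written below as sums over \<open>b\<close> of a bilinear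
  expression in \<open>b\<close> and \<open>sharp x b\<close>.\<close>

definition sharp :: "'a \<Rightarrow> 'a \<Rightarrow> 'a" where
  "sharp x b = (THE u. \<forall>z. G x u z = b \<bullet> z)"

lemma G_sharp: "x \<in> S \<Longrightarrow> G x (sharp x b) z = b \<bullet> z"
proof -
  assume x: "x \<in> S"
  have "linear ((\<bullet>) b)" by (rule bounded_linear.linear[OF bounded_linear_inner_right])
  from theI'[OF G_represents[OF x this]] show ?thesis by (simp add: sharp_def)
qed

lemma G_sharp': "x \<in> S \<Longrightarrow> G x z (sharp x b) = z \<bullet> b"
  using G_sharp[of x b z] sym by (simp add: inner_commute)

text \<open>The resolvent identity
  \<open>inverse Q = inverse P - inverse Q (Q - P) inverse P\<close> for the matrices
  \<open>P\<close>, \<open>Q\<close> of \<open>G x\<close> and \<open>G y\<close>, in components.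
  The increment of the metric becomes a factor that vanishes at \<open>y = x\<close>.\<close>

lemma sharp_expand:
  assumes "x \<in> S" "y \<in> S"
  shows "sharp y b \<bullet> c = b \<bullet> sharp x c
    - (\<Sum>j\<in>Basis. (sharp y b \<bullet> j) * (G y j (sharp x c) - G x j (sharp x c)))"
proof -
  have "G z (sharp y b) (sharp x c) = (\<Sum>j\<in>Basis. (sharp y b \<bullet> j) * G z j (sharp x c))" if "z \<in> S" for z
    by (subst linear_expand[OF linear_G(2)[OF that]]) simp
  then show ?thesis
    using assms G_sharp'[of x "sharp y b" c] G_sharp[of y b "sharp x c"]
    by (simp add: right_diff_distrib sum_subtractf)
qed

text \<open>The resolvent identity bounds the norm of \<open>sharp y b\<close> by \<open>k\<close>
  plus a small multiple of itself. Once this norm is bounded near \<open>x\<close>, the correction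
  term tends to 0.\<close>

lemma isCont_sharp:
  assumes x: "x \<in> S"
  shows "isCont (\<lambda>y. sharp y b) x"
proof -
  let ?d = "\<lambda>y j c. G y j (sharp x c) - G x j (sharp x c)"
  have ev: "\<forall>\<^sub>F y in at x. y \<in> S" using open_S x by (rule eventually_at_in_open')
  have d: "((\<lambda>y. ?d y j c) \<longlongrightarrow> 0) (at x)" for j c
    using smooth_on_continuous[OF smooth] open_S x
    by (simp add: continuous_on_eq_continuous_at isCont_def LIM_zero_iff)
  define k where "k = (\<Sum>c\<in>Basis. \<bar>b \<bullet> sharp x c\<bar>)"
  define m where "m y = (\<Sum>c\<in>Basis. \<Sum>j\<in>Basis. \<bar>?d y j c\<bar>)" for y
  have "(m \<longlongrightarrow> (\<Sum>c\<in>(Basis::'a set). \<Sum>j\<in>(Basis::'a set). \<bar>0\<bar>)) (at x)"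
    unfolding m_def by (intro tendsto_intros d)
  \<comment> \<open>Below 1/2 the multiple of the norm can be absorbed on the left, which gives the
    bound \<open>2 * k\<close>.\<close>
  then have "\<forall>\<^sub>F y in at x. m y < 1/2" by (intro order_tendstoD(2)[of m 0]) simp_all
  then have bdd: "\<forall>\<^sub>F y in at x. norm (sharp y b) \<le> 2 * k"
    using ev
  proof eventually_elim
    case (elim y)
    have "norm (sharp y b) \<le> (\<Sum>c\<in>Basis. \<bar>sharp y b \<bullet> c\<bar>)" by (rule norm_le_l1)
    also have "\<dots> \<le> (\<Sum>c\<in>Basis. \<bar>b \<bullet> sharp x c\<bar> + (\<Sum>j\<in>Basis. norm (sharp y b) * \<bar>?d y j c\<bar>))"
    proof (rule sum_mono)
      fix c :: 'a
      have "\<bar>sharp y b \<bullet> c\<bar> \<le> \<bar>b \<bullet> sharp x c\<bar> + \<bar>\<Sum>j\<in>Basis. (sharp y b \<bullet> j) * ?d y j c\<bar>"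
        unfolding sharp_expand[OF x elim(2), of b c] by (rule abs_triangle_ineq4)
      also have "\<bar>\<Sum>j\<in>Basis. (sharp y b \<bullet> j) * ?d y j c\<bar> \<le> (\<Sum>j\<in>Basis. norm (sharp y b) * \<bar>?d y j c\<bar>)"
        by (rule order_trans[OF sum_abs sum_mono]) (auto simp: abs_mult intro!: mult_right_mono Basis_le_norm)
      finally show "\<bar>sharp y b \<bullet> c\<bar> \<le> \<bar>b \<bullet> sharp x c\<bar> + (\<Sum>j\<in>Basis. norm (sharp y b) * \<bar>?d y j c\<bar>)"
        by simp
    qed
    also have "\<dots> = k + norm (sharp y b) * m y"
      by (simp add: k_def m_def sum.distrib sum_distrib_left)
    also have "\<dots> \<le> k + norm (sharp y b) * (1/2)"
      using elim(1) by (intro add_left_mono mult_left_mono) auto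
    finally show ?case by simp
  qed
  have "((\<lambda>y. sharp y b \<bullet> c) \<longlongrightarrow> sharp x b \<bullet> c) (at x)" for c
  proof -
    have "((\<lambda>y. ?d y j c * (sharp y b \<bullet> j)) \<longlongrightarrow> 0) (at x)" if "j \<in> Basis" for j
      using bdd that
      by (intro lim_null_mult_right_bounded[OF d, of _ "2 * k"])
        (auto elim!: eventually_mono intro: order_trans[OF Basis_le_norm])
    then have "((\<lambda>y. b \<bullet> sharp x c - (\<Sum>j\<in>Basis. ?d y j c * (sharp y b \<bullet> j))) \<longlongrightarrow>
        b \<bullet> sharp x c - (\<Sum>j\<in>(Basis::'a set). 0)) (at x)"
      by (intro tendsto_intros) auto
    moreover have "b \<bullet> sharp x c - (\<Sum>j\<in>(Basis::'a set). 0) = sharp x b \<bullet> c"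
      using sharp_expand[OF x x, of b c] by simp
    ultimately have "((\<lambda>y. b \<bullet> sharp x c - (\<Sum>j\<in>Basis. ?d y j c * (sharp y b \<bullet> j))) \<longlongrightarrow>
        sharp x b \<bullet> c) (at x)" by (simp only:)
    then show ?thesis
    proof (rule Lim_transform_eventually)
      show "\<forall>\<^sub>F y in at x. b \<bullet> sharp x c - (\<Sum>j\<in>Basis. ?d y j c * (sharp y b \<bullet> j)) = sharp y b \<bullet> c"
        using ev by eventually_elim (simp add: sharp_expand[OF x, of _ b c] mult.commute)
    qed
  qed
  then show ?thesis
    unfolding isCont_def tendsto_componentwise_iff[of "\<lambda>y. sharp y b"] by blast
qed

text \<open>In matrix terms, \<open>d(inverse G) = - inverse G dG inverse G\<close>. In the
  resolvent identity the increment of the metric vanishes at \<open>x\<close>, so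
  \<open>has_derivative_mult_vanishing\<close> applies with the continuous factor
  \<open>sharp\<close>.\<close>

lemma has_derivative_sharp:
  assumes x: "x \<in> S"
  shows "((\<lambda>y. sharp y b) has_derivative
    (\<lambda>p. \<Sum>c\<in>Basis. - pd p (\<lambda>y. G y (sharp x b) (sharp x c)) x *\<^sub>R c)) (at x)"
  unfolding has_derivative_componentwise_within[of "\<lambda>y. sharp y b"]
proof
  fix c :: 'a assume c: "c \<in> Basis"
  let ?d = "\<lambda>y j. G y j (sharp x c) - G x j (sharp x c)"
  have "((\<lambda>y. (sharp y b \<bullet> j) * ?d y j) has_derivative
      (\<lambda>p. (sharp x b \<bullet> j) * pd p (\<lambda>y. G y j (sharp x c)) x)) (at x)" for j
    by (rule has_derivative_mult_vanishing)
      (auto intro!: isCont_inner isCont_sharp x derivative_eq_intros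
        smooth_on_has_derivative[OF smooth x])
  then have "((\<lambda>y. b \<bullet> sharp x c - (\<Sum>j\<in>Basis. (sharp y b \<bullet> j) * ?d y j)) has_derivative
      (\<lambda>p. 0 - (\<Sum>j\<in>Basis. (sharp x b \<bullet> j) * pd p (\<lambda>y. G y j (sharp x c)) x))) (at x)"
    by (intro has_derivative_diff has_derivative_const has_derivative_sum)
  moreover have "(\<Sum>j\<in>Basis. (sharp x b \<bullet> j) * pd p (\<lambda>y. G y j (sharp x c)) x)
      = pd p (\<lambda>y. G y (sharp x b) (sharp x c)) x" for p
  proof -
    have "pd p (\<lambda>y. G y (sharp x b) (sharp x c)) x
        = pd p (\<lambda>y. \<Sum>j\<in>Basis. (sharp x b \<bullet> j) *\<^sub>R G y j (sharp x c)) x"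
      by (rule pd_cong[OF open_S x]) (rule linear_expand[OF linear_G(2)])
    also have "\<dots> = (\<Sum>j\<in>Basis. (sharp x b \<bullet> j) *\<^sub>R pd p (\<lambda>y. G y j (sharp x c)) x)"
      by (subst pd_sum[OF _ x])
        (auto intro!: smooth_on_linear_image[OF open_S bounded_linear_scaleR_right smooth] sum.cong
          pd_linear_image[OF bounded_linear_scaleR_right smooth x] simp del: real_scaleR_def)
    finally show ?thesis by simp
  qed
  ultimately have "((\<lambda>y. b \<bullet> sharp x c - (\<Sum>j\<in>Basis. (sharp y b \<bullet> j) * ?d y j)) has_derivative
      (\<lambda>p. (\<Sum>c\<in>Basis. - pd p (\<lambda>y. G y (sharp x b) (sharp x c)) x *\<^sub>R c) \<bullet> c)) (at x)"
    by (simp only: inner_sum_left_Basis[OF c] diff_0)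
  then show "((\<lambda>y. sharp y b \<bullet> c) has_derivative
      (\<lambda>p. (\<Sum>c\<in>Basis. - pd p (\<lambda>y. G y (sharp x b) (sharp x c)) x *\<^sub>R c) \<bullet> c)) (at x)"
    by (rule has_derivative_transform_within_open[OF _ open_S x])
      (simp add: sharp_expand[OF x, of _ b c])
qed

text \<open>Bootstrapping: the derivative is quadratic in \<open>sharp\<close> with derivatives of
  \<open>G\<close> as coefficients, so each order of smoothness yields the next. The induction runs
  over all \<open>b\<close> at once because the derivative mixes them.\<close>

lemma smooth_sharp: "smooth_on S (\<lambda>x. sharp x b)"
  unfolding smooth_on_def
proof
  fix k show "Ck_on k S (\<lambda>x. sharp x b)"
  proof (induction k arbitrary: b)
    case 0
    then show ?case using isCont_sharp by (auto intro: continuous_at_imp_continuous_on)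
  next
    case (Suc k)
    have sum: "Ck_on k S (\<lambda>x. \<Sum>i\<in>I. f i x)" if "\<And>i. i \<in> I \<Longrightarrow> Ck_on k S (f i)" for I :: "'a set" and f :: "'a \<Rightarrow> 'a \<Rightarrow> 'c::real_normed_vector"
      using that by (induction I rule: infinite_finite_induct)
        (auto intro!: Ck_on_const[OF open_S] Ck_on_add[OF open_S])
    have comp: "Ck_on k S (\<lambda>x. sharp x c \<bullet> i)" for c i
      by (rule Ck_on_linear_image[OF open_S bounded_linear_inner_left Suc.IH])
    have "Ck_on k S (\<lambda>x. \<Sum>i\<in>Basis. \<Sum>j\<in>Basis.
        (sharp x b \<bullet> i) * ((sharp x c \<bullet> j) * pd p (\<lambda>y. G y i j) x))" for p c
      using smooth_on_pd[OF smooth] by (intro sum Ck_on_mult[OF open_S] comp) (simp add: smooth_on_def)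
    moreover have "pd p (\<lambda>y. G y (sharp x b) (sharp x c)) x
        = (\<Sum>i\<in>Basis. \<Sum>j\<in>Basis. (sharp x b \<bullet> i) * ((sharp x c \<bullet> j) * pd p (\<lambda>y. G y i j) x))"
      if x: "x \<in> S" for x p c
    proof -
      have "pd p (\<lambda>y. G y (sharp x b) (sharp x c)) x
          = pd p (\<lambda>y. \<Sum>i\<in>Basis. \<Sum>j\<in>Basis. (sharp x b \<bullet> i) * ((sharp x c \<bullet> j) * G y i j)) x"
        by (rule pd_cong[OF open_S x], subst linear_expand[OF linear_G(2)], assumption,
            subst linear_expand[OF linear_G(1)]) (simp_all add: sum_distrib_left)
      then show ?thesis
        by (simp add: pd_sum[OF _ x] smooth_on_sum[OF open_S] smooth_on_mult[OF open_S]
            smooth_on_const[OF open_S] smooth pd_mult[OF _ _ x] pd_const)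
    qed
    ultimately have "Ck_on k S (\<lambda>x. pd p (\<lambda>y. G y (sharp x b) (sharp x c)) x)" for p c
      by (subst Ck_on_cong[OF open_S])
    then have "Ck_on k S (\<lambda>x. - pd p (\<lambda>y. G y (sharp x b) (sharp x c)) x)" for p c
      by (rule Ck_on_linear_image[OF open_S bounded_linear_minus[OF bounded_linear_ident]])
    then have "Ck_on k S (\<lambda>x. \<Sum>c\<in>Basis. - pd p (\<lambda>y. G y (sharp x b) (sharp x c)) x *\<^sub>R c)" for p
      by (intro sum Ck_on_linear_image[OF open_S bounded_linear_scaleR_left])
    then show ?case
      by (intro Ck_on_SucI[OF open_S, of _ "\<lambda>x p. \<Sum>c\<in>Basis. - pd p (\<lambda>y. G y (sharp x b) (sharp x c)) x *\<^sub>R c"]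
          has_derivative_sharp)
  qed
qed

end

section \<open>Christoffel symbols from the Koszul formula\<close>

context local_metric
begin

abbreviation Gam :: "'a \<Rightarrow> 'a \<Rightarrow> 'a \<Rightarrow> 'a" where
  "Gam \<equiv> levi_civita G"

abbreviation koszul :: "'a \<Rightarrow> 'a \<Rightarrow> 'a \<Rightarrow> 'a \<Rightarrow> real" where
  "koszul x v w z \<equiv> pd v (\<lambda>y. G y w z) x + pd w (\<lambda>y. G y v z) x - pd z (\<lambda>y. G y v w) x"

lemma linear_pd_G:
  assumes "x \<in> S"
  shows "linear (\<lambda>p. pd p (\<lambda>y. G y v w) x)" "linear (\<lambda>v. pd p (\<lambda>y. G y v w) x)"
    "linear (\<lambda>w. pd p (\<lambda>y. G y v w) x)"
  by (rule linear_pd[OF smooth assms] linear_pd_param[OF open_S _ smooth assms] linear_G, assumption?)+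

lemmas pd_G_simps =
  linear_add[OF linear_pd_G(1)] linear_add[OF linear_pd_G(2)] linear_add[OF linear_pd_G(3)]
  linear_cmul[OF linear_pd_G(1)] linear_cmul[OF linear_pd_G(2)] linear_cmul[OF linear_pd_G(3)]

lemma linear_koszul: "x \<in> S \<Longrightarrow> linear (koszul x v w)"
  by (intro linear_compose_add linear_compose_sub linear_pd_G)

lemma levi_civita_eqI:
  assumes x: "x \<in> S" and u: "\<And>z. 2 * G x u z = koszul x v w z"
  shows "Gam x v w = u"
  unfolding levi_civita_def pd_def[symmetric]
proof (rule the_equality)
  show "\<forall>z. 2 * G x u z = koszul x v w z" using u by simp
  show "u' = u" if "\<forall>z. 2 * G x u' z = koszul x v w z" for u'
    using that u by (intro G_cancel[OF x]) (metis mult_cancel_left zero_neq_numeral)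
qed

lemma G_levi_civita:
  assumes x: "x \<in> S"
  shows "2 * G x (Gam x v w) z = koszul x v w z"
proof -
  have "linear (\<lambda>z. (1/2) * koszul x v w z)"
    using linear_compose_scale_right[OF linear_koszul[OF x], of "1/2"] by (simp only: real_scaleR_def)
  from ex1_implies_ex[OF G_represents[OF x this]] obtain u where *: "\<forall>z. G x u z = (1/2) * koszul x v w z" by blast
  have u: "2 * G x u z = koszul x v w z" for z using spec[OF *, of z] by simp
  show ?thesis unfolding levi_civita_eqI[OF x u] by (rule u)
qed

lemma Gam_sym: "x \<in> S \<Longrightarrow> Gam x v w = Gam x w v"
proof (rule levi_civita_eqI)
  assume x: "x \<in> S"
  have "pd z (\<lambda>y. G y v w) x = pd z (\<lambda>y. G y w v) x" for z
    by (rule pd_cong[OF open_S x sym])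
  then show "2 * G x (Gam x w v) z = koszul x v w z" for z
    unfolding G_levi_civita[OF x] by simp
qed

lemma linear_Gam: "x \<in> S \<Longrightarrow> linear (Gam x v)" "x \<in> S \<Longrightarrow> linear (\<lambda>v. Gam x v w)"
proof -
  assume x: "x \<in> S"
  show lin: "linear (Gam x v)" for v
  proof (rule linearI)
    show "Gam x v (a + b) = Gam x v a + Gam x v b" for a b
      by (rule levi_civita_eqI[OF x])
        (simp add: G_simps[OF x] distrib_left G_levi_civita[OF x] pd_G_simps[OF x])
    show "Gam x v (c *\<^sub>R a) = c *\<^sub>R Gam x v a" for c a
    proof (rule levi_civita_eqI[OF x])
      fix z
      have "2 * G x (c *\<^sub>R Gam x v a) z = c * (2 * G x (Gam x v a) z)" by (simp add: G_simps[OF x])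
      then show "2 * G x (c *\<^sub>R Gam x v a) z = koszul x v (c *\<^sub>R a) z"
        unfolding G_levi_civita[OF x] by (simp add: pd_G_simps[OF x] algebra_simps)
    qed
  qed
  show "linear (\<lambda>v. Gam x v w)"
    using lin[of w] Gam_sym[OF x] by (metis (no_types, lifting) ext)
qed

lemma bilinear_Gam: "x \<in> S \<Longrightarrow> bilinear (Gam x)"
  using linear_Gam by (simp add: bilinear_def)

text \<open>The Koszul formula makes every pairing of \<open>Gam x v w\<close> with a fixed vector
  smooth; pairing with \<open>sharp x b\<close> reads off the component along
  \<open>b\<close>.\<close>

lemma smooth_Gam: "smooth_on S (\<lambda>x. Gam x v w)"
proof -
  have *: "smooth_on S (\<lambda>x. 2 * G x (Gam x v w) z)" for z
    by (rule smooth_on_cong[OF open_S G_levi_civita, THEN iffD2], assumption)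
      (intro smooth_on_add smooth_on_diff open_S smooth_on_pd smooth)
  have "smooth_on S (\<lambda>x. (1/2) * (2 * G x (Gam x v w) (sharp x b)))" for b
    by (rule smooth_on_linear_image[OF open_S bounded_linear_mult_right],
        rule smooth_on_linear_family[OF open_S _ * smooth_sharp])
      (use linear_compose_scale_right[OF linear_G(1), of _ 2] in \<open>simp only: real_scaleR_def\<close>)
  then have "smooth_on S (\<lambda>x. \<Sum>b\<in>Basis. ((1/2) * (2 * G x (Gam x v w) (sharp x b))) *\<^sub>R b)"
    by (intro smooth_on_sum smooth_on_linear_image[OF open_S bounded_linear_scaleR_left] open_S)
  then show ?thesis
    by (rule smooth_on_cong[OF open_S, THEN iffD1, rotated])
      (simp add: G_sharp' euclidean_representation)
qed

lemma smooth_Gam_fields: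
  "smooth_on S X \<Longrightarrow> smooth_on S Y \<Longrightarrow> smooth_on S (\<lambda>x. Gam x (X x) (Y x))"
  by (rule smooth_on_bilinear_family[OF open_S bilinear_Gam smooth_Gam])

lemma smooth_G_fields:
  "smooth_on S X \<Longrightarrow> smooth_on S Y \<Longrightarrow> smooth_on S (\<lambda>x. G x (X x) (Y x))"
  by (rule smooth_on_bilinear_family[OF open_S bilin smooth])

lemma pd_Gam_fields:
  "smooth_on S X \<Longrightarrow> smooth_on S Y \<Longrightarrow> x \<in> S \<Longrightarrow>
    pd p (\<lambda>x. Gam x (X x) (Y x)) x = pd p (\<lambda>y. Gam y (X x) (Y x)) x
      + Gam x (pd p X x) (Y x) + Gam x (X x) (pd p Y x)"
  by (rule pd_bilinear_family[OF open_S bilinear_Gam smooth_Gam])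

text \<open>In the sum of the Koszul formulas for \<open>(p, v, w)\<close> and
  \<open>(p, w, v)\<close> everything cancels except twice the derivative along
  \<open>p\<close>.\<close>

lemma metric_compat:
  assumes x: "x \<in> S"
  shows "pd p (\<lambda>y. G y v w) x = G x (Gam x p v) w + G x v (Gam x p w)"
proof -
  have c: "pd a (\<lambda>y. G y b c) x = pd a (\<lambda>y. G y c b) x" for a b c
    by (rule pd_cong[OF open_S x sym])
  have "2 * (G x (Gam x p v) w + G x (Gam x p w) v) = koszul x p v w + koszul x p w v"
    unfolding distrib_left G_levi_civita[OF x] ..
  also have "\<dots> = 2 * pd p (\<lambda>y. G y v w) x" using c[of p w v] c[of w] c[of v] by simp
  finally show ?thesis using sym[OF x, of v] by simp
qed

lemma pd_G_fields:
  assumes X: "smooth_on S X" and Y: "smooth_on S Y" and x: "x \<in> S"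
  shows "pd p (\<lambda>x. G x (X x) (Y x)) x
    = G x (pd p X x + Gam x p (X x)) (Y x) + G x (X x) (pd p Y x + Gam x p (Y x))"
  using pd_bilinear_family[OF open_S bilin smooth X Y x, of p]
  by (simp add: metric_compat[OF x] G_simps[OF x])

lemmas Gam_simps = linear_add[OF linear_Gam(1)] linear_add[OF linear_Gam(2)]
  linear_diff[OF linear_Gam(1)] linear_diff[OF linear_Gam(2)]
  linear_cmul[OF linear_Gam(1)] linear_cmul[OF linear_Gam(2)]
  linear_neg[OF linear_Gam(1)] linear_neg[OF linear_Gam(2)]

section \<open>The curvature tensor and its algebraic symmetries\<close>

abbreviation Rm :: "'a \<Rightarrow> 'a \<Rightarrow> 'a \<Rightarrow> 'a \<Rightarrow> 'a" where
  "Rm \<equiv> riemann G"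

lemma riemann_pd:
  "Rm x u v w = pd u (\<lambda>y. Gam y v w) x + Gam x u (Gam x v w)
    - pd v (\<lambda>y. Gam y u w) x - Gam x v (Gam x u w)"
  by (simp add: riemann_def pd_def)

lemma smooth_Rm: "smooth_on S (\<lambda>x. Rm x u v w)"
  unfolding riemann_pd
  by (intro smooth_on_add smooth_on_diff smooth_on_pd smooth_Gam smooth_Gam_fields
      smooth_on_const open_S)

lemma linear_pd_Gam:
  assumes "x \<in> S"
  shows "linear (\<lambda>p. pd p (\<lambda>y. Gam y v w) x)" "linear (\<lambda>v. pd p (\<lambda>y. Gam y v w) x)"
    "linear (\<lambda>w. pd p (\<lambda>y. Gam y v w) x)"
  by (rule linear_pd[OF smooth_Gam assms] linear_pd_param[OF open_S _ smooth_Gam assms] linear_Gam, assumption?)+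

lemma linear_Rm:
  assumes "x \<in> S"
  shows "linear (\<lambda>u. Rm x u v w)" "linear (\<lambda>v. Rm x u v w)" "linear (\<lambda>w. Rm x u v w)"
  unfolding riemann_pd
  by (intro linear_compose_add linear_compose_sub linear_pd_Gam assms linear_Gam
      linear_compose[OF linear_Gam(1) linear_Gam(1), unfolded o_def]
      linear_compose[OF linear_Gam(2) linear_Gam(1), unfolded o_def])+

lemma Rm_antisym: "Rm x u v w = - Rm x v u w"
  by (simp add: riemann_pd)

lemma Rm_bianchi1:
  assumes x: "x \<in> S"
  shows "Rm x u v w + Rm x v w u + Rm x w u v = 0"
proof -
  have c: "pd a (\<lambda>y. Gam y b c) x = pd a (\<lambda>y. Gam y c b) x" for a b c
    by (rule pd_cong[OF open_S x Gam_sym])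
  show ?thesis
    by (simp add: riemann_pd c[of u w v] c[of v w u] c[of w v u]
        Gam_sym[OF x, of w v] Gam_sym[OF x, of w u] Gam_sym[OF x, of v u])
qed

text \<open>Metric compatibility, applied twice, expresses the second derivatives of
  \<open>G y w z\<close> through the connection; their symmetry in \<open>u\<close> and
  \<open>v\<close> leaves exactly the curvature terms.\<close>

lemma Rm_skew:
  assumes x: "x \<in> S"
  shows "G x (Rm x u v w) z = - G x w (Rm x u v z)"
proof -
  have c: "smooth_on S (\<lambda>x. a)" for a :: 'a by (rule smooth_on_const[OF open_S])
  have "pd q (pd p (\<lambda>y. G y w z)) x
      = G x (pd q (\<lambda>y. Gam y p w) x + Gam x q (Gam x p w)) z + G x (Gam x p w) (Gam x q z)
        + (G x (Gam x q w) (Gam x p z) + G x w (pd q (\<lambda>y. Gam y p z) x + Gam x q (Gam x p z)))" for p q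
  proof -
    have "pd q (pd p (\<lambda>y. G y w z)) x = pd q (\<lambda>y. G y (Gam y p w) z + G y w (Gam y p z)) x"
      by (rule pd_cong[OF open_S x metric_compat])
    also have "\<dots> = pd q (\<lambda>y. G y (Gam y p w) z) x + pd q (\<lambda>y. G y w (Gam y p z)) x"
      by (intro pd_add[OF _ _ x] smooth_G_fields smooth_Gam c)
    finally show ?thesis
      by (simp add: pd_G_fields[OF smooth_Gam c x] pd_G_fields[OF c smooth_Gam x] pd_const)
  qed
  from this[of u v] this[of v u] show ?thesis
    using pd_commute[OF open_S smooth x, of u v w z]
    by (simp add: riemann_pd G_simps[OF x])
qed

end

text \<open>The classical octahedron argument: combining the Bianchi sums of four triples with the
  two antisymmetries. With all instances listed it is linear arithmetic over the values of
  \<open>E\<close>.\<close>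

lemma curvature_pair_symmetry:
  fixes E :: "'a \<Rightarrow> 'a \<Rightarrow> 'a \<Rightarrow> 'a \<Rightarrow> real"
  assumes 1: "\<And>u v w z. E u v w z = - E v u w z" and 2: "\<And>u v w z. E u v w z = - E u v z w"
    and 3: "\<And>u v w z. E u v w z + E v w u z + E w u v z = 0"
  shows "E u v w z = E w z u v"
  using 3[of u v w z] 3[of v w z u] 3[of w z u v] 3[of z u v w]
    1[of u v w z] 1[of u v z w] 1[of v w u z] 1[of v w z u] 1[of w u v z] 1[of w u z v]
    1[of w z u v] 1[of w z v u] 1[of v z w u] 1[of v z u w] 1[of z u v w] 1[of z u w v]
    2[of u v w z] 2[of v w u z] 2[of w u v z] 2[of v w z u] 2[of w z u v] 2[of z v w u] 2[of v z u w]
    2[of z u v w] 2[of u w v z] 2[of v u w z] 2[of u w z v] 2[of z v u w] 2[of v z w u] 2[of w z v u]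
  by linarith

context local_metric
begin

lemma Rm_pair:
  assumes x: "x \<in> S"
  shows "G x (Rm x u v w) z = G x (Rm x w z u) v"
proof (rule curvature_pair_symmetry[where E = "\<lambda>u v w z. G x (Rm x u v w) z"])
  fix u v w z
  show "G x (Rm x u v w) z = - G x (Rm x v u w) z"
    unfolding Rm_antisym[of x u] by (simp add: G_simps[OF x])
  show "G x (Rm x u v w) z = - G x (Rm x u v z) w"
    unfolding Rm_skew[OF x, of u v w] sym[OF x, of w] ..
  show "G x (Rm x u v w) z + G x (Rm x v w u) z + G x (Rm x w u v) z = 0"
    using Rm_bianchi1[OF x, of u v w] by (simp flip: G_simps[OF x]) (simp add: G_simps[OF x])
qed

end

section \<open>The contracted Bianchi identity\<close>

context local_metric
begin

text \<open>The matrix of components of \<open>sharp x\<close> is symmetric, being the inverse of a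
  symmetric one.\<close>

lemma sum_sharp_swap:
  fixes \<Phi> :: "'a \<Rightarrow> 'a \<Rightarrow> real"
  assumes x: "x \<in> S" and lin: "\<And>p. linear (\<Phi> p)" "\<And>q. linear (\<lambda>p. \<Phi> p q)"
  shows "(\<Sum>b\<in>Basis. \<Phi> b (sharp x b)) = (\<Sum>b\<in>Basis. \<Phi> (sharp x b) b)"
proof -
  have "sharp x b \<bullet> c = sharp x c \<bullet> b" for b c
    using G_sharp[OF x, of b "sharp x c"] G_sharp'[OF x, of "sharp x b" c]
    by (simp add: inner_commute)
  moreover have "\<Phi> b (sharp x b) = (\<Sum>c\<in>Basis. (sharp x b \<bullet> c) * \<Phi> b c)" for b
    using linear_expand[OF lin(1), of b "sharp x b"] by simp
  moreover have "\<Phi> (sharp x b) b = (\<Sum>c\<in>Basis. (sharp x b \<bullet> c) * \<Phi> c b)" for b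
    using linear_expand[OF lin(2), of "sharp x b" b] by simp
  ultimately show ?thesis
    using sum.swap[of "\<lambda>b c. (sharp x b \<bullet> c) * \<Phi> b c" Basis Basis] by simp
qed

section \<open>Ricci curvature and covariant derivatives of curvature\<close>

abbreviation Ric :: "'a \<Rightarrow> 'a \<Rightarrow> 'a \<Rightarrow> real" where
  "Ric \<equiv> ricci G"

lemma linear_Ric:
  assumes "x \<in> S"
  shows "linear (Ric x v)" "linear (\<lambda>v. Ric x v w)"
  unfolding ricci_def
  by (intro linear_compose_sum ballI linear_compose[OF linear_Rm(2)[OF assms], unfolded o_def]
      linear_compose[OF linear_Rm(3)[OF assms], unfolded o_def]
      bounded_linear.linear[OF bounded_linear_inner_left])+

lemma bilinear_Ric: "x \<in> S \<Longrightarrow> bilinear (Ric x)"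
  using linear_Ric by (simp add: bilinear_def)

lemma smooth_Ric: "smooth_on S (\<lambda>x. Ric x v w)"
  unfolding ricci_def
  by (intro smooth_on_sum smooth_on_linear_image[OF open_S bounded_linear_inner_left smooth_Rm] open_S)

lemma pd_Ric:
  assumes x: "x \<in> S"
  shows "pd p (\<lambda>y. Ric y v w) x = (\<Sum>b\<in>Basis. pd p (\<lambda>y. Rm y b v w) x \<bullet> b)"
  unfolding ricci_def
  by (subst pd_sum[OF _ x])
    (auto intro!: sum.cong smooth_on_linear_image[OF open_S bounded_linear_inner_left smooth_Rm]
      pd_linear_image[OF bounded_linear_inner_left smooth_Rm x])

text \<open>The tensor \<open>(\<nabla>\<^sub>a R)(u,v)w\<close>; as \<open>u\<close>,
  \<open>v\<close>, \<open>w\<close> are constant fields, their covariant derivatives along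
  \<open>a\<close> are pure Christoffel terms.\<close>

definition cov_Rm :: "'a \<Rightarrow> 'a \<Rightarrow> 'a \<Rightarrow> 'a \<Rightarrow> 'a \<Rightarrow> 'a" where
  "cov_Rm x a u v w = pd a (\<lambda>y. Rm y u v w) x + Gam x a (Rm x u v w)
    - Rm x (Gam x a u) v w - Rm x u (Gam x a v) w - Rm x u v (Gam x a w)"

definition cov_Ric :: "'a \<Rightarrow> 'a \<Rightarrow> 'a \<Rightarrow> 'a \<Rightarrow> real" where
  "cov_Ric x a v w = pd a (\<lambda>y. Ric y v w) x - Ric x (Gam x a v) w - Ric x v (Gam x a w)"

lemma pd_Rm:
  assumes x: "x \<in> S"
  shows "pd a (\<lambda>y. Rm y u v w) x
    = pd a (pd u (\<lambda>y. Gam y v w)) x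
      + (pd a (\<lambda>y. Gam y u (Gam x v w)) x + Gam x u (pd a (\<lambda>y. Gam y v w) x))
      - pd a (pd v (\<lambda>y. Gam y u w)) x
      - (pd a (\<lambda>y. Gam y v (Gam x u w)) x + Gam x v (pd a (\<lambda>y. Gam y u w) x))"
proof -
  have c: "smooth_on S (\<lambda>x. a)" for a :: 'a by (rule smooth_on_const[OF open_S])
  have 1: "pd a (\<lambda>y. Gam y u (Gam y v w)) x
      = pd a (\<lambda>y. Gam y u (Gam x v w)) x + Gam x u (pd a (\<lambda>y. Gam y v w) x)" for u v
    using pd_Gam_fields[OF c smooth_Gam x, of a u v w] by (simp add: pd_const linear_0[OF linear_Gam(2)[OF x]])
  have "pd a (\<lambda>y. Rm y u v w) x
      = pd a (pd u (\<lambda>y. Gam y v w)) x + pd a (\<lambda>y. Gam y u (Gam y v w)) x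
        - pd a (pd v (\<lambda>y. Gam y u w)) x - pd a (\<lambda>y. Gam y v (Gam y u w)) x"
    unfolding riemann_pd
    by (simp add: pd_add[OF _ _ x] pd_diff[OF _ _ x] smooth_on_add[OF open_S] smooth_on_diff[OF open_S]
        smooth_on_pd smooth_Gam smooth_Gam_fields c)
  then show ?thesis unfolding 1 .
qed

text \<open>Second derivatives of the Christoffel symbols cancel because partial derivatives
  commute, the remaining terms by \<open>Gam_sym\<close>.\<close>

lemma cov_Rm_bianchi2:
  assumes x: "x \<in> S"
  shows "cov_Rm x a b v w + cov_Rm x b v a w + cov_Rm x v a b w = 0"
proof -
  have c: "pd p (pd q (\<lambda>y. Gam y u w)) x = pd q (pd p (\<lambda>y. Gam y u w)) x" for p q u
    by (rule pd_commute[OF open_S smooth_Gam x])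
  show ?thesis
    unfolding cov_Rm_def pd_Rm[OF x]
    unfolding riemann_pd
    by (simp add: Gam_simps[OF x] c[of b a] c[of v a] c[of v b] Gam_sym[OF x, of b a]
        Gam_sym[OF x, of v a] Gam_sym[OF x, of v b] algebra_simps)
qed

lemma cov_Rm_antisym: "x \<in> S \<Longrightarrow> cov_Rm x a u v w = - cov_Rm x a v u w"
proof -
  assume x: "x \<in> S"
  have "pd a (\<lambda>y. Rm y u v w) x = pd a (\<lambda>y. - Rm y v u w) x"
    by (rule pd_cong[OF open_S x Rm_antisym])
  also have "\<dots> = - pd a (\<lambda>y. Rm y v u w) x"
    by (rule pd_linear_image[OF bounded_linear_minus[OF bounded_linear_ident] smooth_Rm x])
  finally show ?thesis
    unfolding cov_Rm_def Rm_antisym[of x u v] Rm_antisym[of x "Gam x a u" v] Rm_antisym[of x u "Gam x a v"]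
    by (simp add: Gam_simps[OF x])
qed

lemma linear_cov_Rm: "x \<in> S \<Longrightarrow> linear (\<lambda>u. cov_Rm x a u v w)"
  unfolding cov_Rm_def
  by (intro linear_compose_add linear_compose_sub linear_pd_param[OF open_S linear_Rm(1) smooth_Rm]
      linear_compose[OF linear_Rm(1) linear_Gam(1), unfolded o_def]
      linear_compose[OF linear_Gam(1) linear_Rm(1), unfolded o_def] linear_Rm)

lemma G_cov_Rm:
  assumes x: "x \<in> S"
  shows "G x (cov_Rm x a u v w) z = pd a (\<lambda>y. G y (Rm y u v w) z) x - G x (Rm x (Gam x a u) v w) z
    - G x (Rm x u (Gam x a v) w) z - G x (Rm x u v (Gam x a w)) z - G x (Rm x u v w) (Gam x a z)"
  using pd_G_fields[OF smooth_Rm smooth_on_const[OF open_S] x, of a u v w z]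
  by (simp add: cov_Rm_def G_simps[OF x] pd_const)

text \<open>A covariant derivative inherits the symmetries of its tensor: \<open>Rm_pair\<close>
  holds on all of \<open>S\<close> and may be differentiated.\<close>

lemma cov_Rm_pair:
  assumes x: "x \<in> S"
  shows "G x (cov_Rm x a u v w) z = G x (cov_Rm x a w z u) v"
proof -
  have "pd a (\<lambda>y. G y (Rm y u v w) z) x = pd a (\<lambda>y. G y (Rm y w z u) v) x"
    by (rule pd_cong[OF open_S x Rm_pair])
  then show ?thesis
    unfolding G_cov_Rm[OF x] Rm_pair[OF x, of _ v w z] Rm_pair[OF x, of u _ w z] Rm_pair[OF x, of u v _ z]
      Rm_pair[OF x, of u v w] by simp
qed

lemma cov_Rm_skew:
  assumes x: "x \<in> S"
  shows "G x (cov_Rm x a u v w) z = - G x (cov_Rm x a u v z) w"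
  using cov_Rm_pair[OF x, of a u v w z] cov_Rm_pair[OF x, of a u v z w] cov_Rm_antisym[OF x, of a w z u]
  by (simp add: G_simps[OF x])

text \<open>Contraction commutes with covariant differentiation, since the Christoffel term on the
  value and the one in the traced slot have the same trace.\<close>

lemma cov_Ric_trace:
  assumes x: "x \<in> S"
  shows "cov_Ric x a v w = (\<Sum>b\<in>Basis. cov_Rm x a b v w \<bullet> b)"
proof -
  have "(\<Sum>b\<in>Basis. Gam x a (Rm x b v w) \<bullet> b) = (\<Sum>b\<in>Basis. Rm x (Gam x a b) v w \<bullet> b)"
    by (rule sum_trace_commute[OF linear_Gam(1)[OF x] linear_Rm(1)[OF x]])
  then show ?thesis
    unfolding cov_Ric_def cov_Rm_def pd_Ric[OF x]
    by (simp add: ricci_def inner_diff_left inner_add_left sum.distrib sum_subtractf)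
qed

text \<open>This is \<open>d scal = 2 div Ric\<close> at \<open>v\<close>, the factor 2 being
  realised by the two argument orders of \<open>cov_Ric\<close>. It arises by tracing the second
  Bianchi identity twice.\<close>

theorem contracted_bianchi:
  assumes x: "x \<in> S"
  shows "(\<Sum>b\<in>Basis. cov_Ric x v b (sharp x b))
    = (\<Sum>b\<in>Basis. cov_Ric x b v (sharp x b) + cov_Ric x b (sharp x b) v)"
proof -
  have "(\<Sum>a\<in>Basis. cov_Rm x a b v (sharp x b) \<bullet> a) - cov_Ric x b v (sharp x b) + cov_Ric x v b (sharp x b) = 0" for b
  proof -
    have "cov_Rm x a b v (sharp x b) - cov_Rm x b a v (sharp x b) + cov_Rm x v a b (sharp x b) = 0" for a
      using cov_Rm_bianchi2[OF x, of a b v "sharp x b"] cov_Rm_antisym[OF x, of b v a] by simp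
    then have "(\<Sum>a\<in>Basis. (cov_Rm x a b v (sharp x b) - cov_Rm x b a v (sharp x b) + cov_Rm x v a b (sharp x b)) \<bullet> a) = 0"
      by simp
    then show ?thesis
      by (simp add: cov_Ric_trace[OF x] inner_diff_left inner_add_left sum.distrib sum_subtractf)
  qed
  then have "(\<Sum>b\<in>Basis. (\<Sum>a\<in>Basis. cov_Rm x a b v (sharp x b) \<bullet> a)
      - cov_Ric x b v (sharp x b) + cov_Ric x v b (sharp x b)) = 0" by simp
  \<comment> \<open>The remaining double trace is a divergence in disguise: pair symmetry and
    skewness move \<open>v\<close> to the last slot, and exchanging \<open>b\<close> with
    \<open>sharp x b\<close> turns the sum over \<open>b\<close> into a Ricci trace.\<close>
  moreover have "(\<Sum>b\<in>Basis. \<Sum>a\<in>Basis. cov_Rm x a b v (sharp x b) \<bullet> a) = - (\<Sum>a\<in>Basis. cov_Ric x a (sharp x a) v)"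
  proof -
    have "cov_Rm x a b v (sharp x b) \<bullet> a = - G x (cov_Rm x a (sharp x b) (sharp x a) v) b" for a b
      unfolding G_sharp'[OF x, symmetric] cov_Rm_pair[OF x, of a b v]
      by (rule cov_Rm_skew[OF x])
    then have 1: "(\<Sum>b\<in>Basis. cov_Rm x a b v (sharp x b) \<bullet> a) = - (\<Sum>b\<in>Basis. G x (cov_Rm x a (sharp x b) (sharp x a) v) b)" for a
      by (simp add: sum_negf)
    have 2: "(\<Sum>b\<in>Basis. G x (cov_Rm x a (sharp x b) (sharp x a) v) b)
        = (\<Sum>b\<in>Basis. G x (cov_Rm x a b (sharp x a) v) (sharp x b))" for a
      by (rule sum_sharp_swap[OF x, symmetric])
        (intro linear_G x linear_compose[OF linear_cov_Rm linear_G(2), unfolded o_def])+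
    show ?thesis
      by (subst sum.swap) (simp add: 1 2 cov_Ric_trace[OF x] G_sharp'[OF x] sum_negf)
  qed
  ultimately show ?thesis by (simp add: sum.distrib sum_subtractf)
qed

end

section \<open>Invariance of connection and curvature under a Killing field\<close>

locale local_killing = local_metric +
  fixes Z :: "'a \<Rightarrow> 'a"
  assumes smooth_Z: "smooth_on S Z" and killing: "x \<in> S \<Longrightarrow> lie_metric Z G x v w = 0"
begin

lemma killing_pd:
  "x \<in> S \<Longrightarrow> pd (Z x) (\<lambda>y. G y v w) x + G x (pd v Z x) w + G x v (pd w Z x) = 0"
  using killing[of x v w] by (simp add: lie_metric_def pd_def)

lemma killing_pd2:
  assumes x: "x \<in> S"
  shows "pd p (pd (Z x) (\<lambda>y. G y v w)) x + pd (pd p Z x) (\<lambda>y. G y v w) x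
    + (pd p (\<lambda>y. G y (pd v Z x) w) x + G x (pd p (pd v Z) x) w)
    + (pd p (\<lambda>y. G y v (pd w Z x)) x + G x v (pd p (pd w Z) x)) = 0"
proof -
  have c: "smooth_on S (\<lambda>x. a)" for a :: 'a by (rule smooth_on_const[OF open_S])
  note sZ = smooth_on_pd[OF smooth_Z]
  have "pd p (\<lambda>x. pd (Z x) (\<lambda>y. G y v w) x + G x (pd v Z x) w + G x v (pd w Z x)) x = pd p (\<lambda>x. 0) x"
    by (rule pd_cong[OF open_S x killing_pd])
  also have "pd p (\<lambda>x. pd (Z x) (\<lambda>y. G y v w) x + G x (pd v Z x) w + G x v (pd w Z x)) x
      = pd p (\<lambda>x. pd (Z x) (\<lambda>y. G y v w) x) x + pd p (\<lambda>x. G x (pd v Z x) w) x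
        + pd p (\<lambda>x. G x v (pd w Z x)) x"
    by (simp add: pd_add[OF _ _ x] smooth_on_add[OF open_S] smooth_on_pd_along[OF open_S smooth smooth_Z]
        smooth_G_fields c sZ)
  finally show ?thesis
    using pd_bilinear_family[OF open_S bilin smooth sZ c x, of p v w]
      pd_bilinear_family[OF open_S bilin smooth c sZ x, of p v w]
    by (simp add: pd_const pd_pd_along[OF open_S smooth smooth_Z x] G_simps[OF x])
qed

text \<open>Invariance of the connection under \<open>Z\<close>, solved for the second derivatives
  of \<open>Z\<close>. The Koszul formula is differentiated along \<open>Z\<close>, and the Killing
  equation, itself differentiated along \<open>v\<close>, \<open>w\<close> and \<open>z\<close>,
  replaces the resulting second derivatives of the metric.\<close>

lemma lie_Gam:
  assumes x: "x \<in> S"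
  shows "pd v (pd w Z) x = pd (Gam x v w) Z x - pd (Z x) (\<lambda>y. Gam y v w) x
    - Gam x (pd v Z x) w - Gam x v (pd w Z x)"
proof (rule G_cancel[OF x])
  fix z
  let ?\<zeta> = "Z x" and ?g = "\<lambda>a b y. G y a b"
  have c: "smooth_on S (\<lambda>x. a)" for a :: 'a by (rule smooth_on_const[OF open_S])
  have s: "pd a (?g b c) x = pd a (?g c b) x" for a b c
    by (rule pd_cong[OF open_S x sym])
  have s2: "pd a (pd d (?g b c)) x = pd a (pd d (?g c b)) x" for a b c d
    by (rule pd_cong[OF open_S x], rule pd_cong[OF open_S _ sym])
  have comm: "pd a (pd ?\<zeta> (?g b c)) x = pd ?\<zeta> (pd a (?g b c)) x" for a b c
    by (rule pd_commute[OF open_S smooth x])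
  have cZ: "pd a (pd b Z) x = pd b (pd a Z) x" for a b by (rule pd_commute[OF open_S smooth_Z x])
  have "pd ?\<zeta> (\<lambda>y. 2 * G y (Gam y v w) z) x = pd ?\<zeta> (\<lambda>y. koszul y v w z) x"
    by (rule pd_cong[OF open_S x G_levi_civita])
  also have "pd ?\<zeta> (\<lambda>y. koszul y v w z) x
      = pd ?\<zeta> (pd v (?g w z)) x + pd ?\<zeta> (pd w (?g v z)) x - pd ?\<zeta> (pd z (?g v w)) x"
    by (simp add: pd_add[OF _ _ x] pd_diff[OF _ _ x] smooth_on_add[OF open_S] smooth_on_pd smooth)
  also have "pd ?\<zeta> (\<lambda>y. 2 * G y (Gam y v w) z) x
      = 2 * (pd ?\<zeta> (?g (Gam x v w) z) x + G x (pd ?\<zeta> (\<lambda>y. Gam y v w) x) z)"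
    using pd_bilinear_family[OF open_S bilin smooth smooth_Gam c x, of ?\<zeta> v w z]
    by (simp add: pd_linear_image[OF bounded_linear_mult_right smooth_G_fields[OF smooth_Gam c] x]
        pd_const G_simps[OF x])
  finally have k: "2 * (pd ?\<zeta> (?g (Gam x v w) z) x + G x (pd ?\<zeta> (\<lambda>y. Gam y v w) x) z)
      = pd ?\<zeta> (pd v (?g w z)) x + pd ?\<zeta> (pd w (?g v z)) x - pd ?\<zeta> (pd z (?g v w)) x" .
  note K = killing_pd2[OF x, of v w z] killing_pd2[OF x, of w v z] killing_pd2[OF x, of z v w]
    killing_pd[OF x, of "Gam x v w" z]
    G_levi_civita[OF x, of "pd v Z x" w z] G_levi_civita[OF x, of v "pd w Z x" z]
    G_levi_civita[OF x, of v w "pd z Z x"]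
  show "G x (pd v (pd w Z) x) z = G x (pd (Gam x v w) Z x - pd (Z x) (\<lambda>y. Gam y v w) x
    - Gam x (pd v Z x) w - Gam x v (pd w Z x)) z"
    using k K
    unfolding comm G_simps[OF x] cZ[of w v] cZ[of z v] cZ[of z w]
      sym[OF x, of w "pd v (pd z Z) x"] sym[OF x, of v "pd w (pd z Z) x"]
      s[of _ w "pd v Z x"] s[of _ "pd w Z x" v] 
    by simp
qed


text \<open>The Lie derivative of the connection vanishes identically; differentiating this once more and
  antisymmetrising gives the Lie derivative of the curvature.\<close>

lemma lie_Rm:
  assumes x: "x \<in> S"
  shows "pd (Z x) (\<lambda>y. Rm y u v w) x = pd (Rm x u v w) Z x - Rm x (pd u Z x) v w
    - Rm x u (pd v Z x) w - Rm x u v (pd w Z x)"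
proof -
  let ?\<zeta> = "Z x" and ?J = "\<lambda>v. pd v Z x"
  have c: "smooth_on S (\<lambda>x. a)" for a :: 'a by (rule smooth_on_const[OF open_S])
  note sZ = smooth_on_pd[OF smooth_Z]
  have J: "linear ?J" by (rule linear_pd[OF smooth_Z x])
  have *: "pd u (pd v (pd w Z)) x
    = pd u (pd (Gam x v w) Z) x + ?J (pd u (\<lambda>y. Gam y v w) x)
      - (pd u (pd ?\<zeta> (\<lambda>y. Gam y v w)) x + pd (?J u) (\<lambda>y. Gam y v w) x)
      - (pd u (\<lambda>y. Gam y (?J v) w) x + Gam x (pd u (pd v Z) x) w)
      - (pd u (\<lambda>y. Gam y v (?J w)) x + Gam x v (pd u (pd w Z) x))" for u v
  proof -
    have "pd u (pd v (pd w Z)) x = pd u (\<lambda>x. pd (Gam x v w) Z x - pd (Z x) (\<lambda>y. Gam y v w) x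
      - Gam x (pd v Z x) w - Gam x v (pd w Z x)) x"
      by (rule pd_cong[OF open_S x lie_Gam])
    also have "\<dots> = pd u (\<lambda>x. pd (Gam x v w) Z x) x - pd u (\<lambda>x. pd (Z x) (\<lambda>y. Gam y v w) x) x
      - pd u (\<lambda>x. Gam x (pd v Z x) w) x - pd u (\<lambda>x. Gam x v (pd w Z x)) x"
      by (simp add: pd_diff[OF _ _ x] smooth_on_diff[OF open_S] smooth_on_pd_along[OF open_S]
          smooth_Gam smooth_Z smooth_Gam_fields c sZ)
    finally show ?thesis
      by (simp add: pd_pd_along[OF open_S _ _ x] smooth_Gam smooth_Z pd_Gam_fields[OF sZ c x]
          pd_Gam_fields[OF c sZ x] pd_const linear_0[OF linear_Gam(1)[OF x]] linear_0[OF linear_Gam(2)[OF x]])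
  qed
  have "pd u (pd v (pd w Z)) x = pd v (pd u (pd w Z)) x" by (rule pd_commute[OF open_S sZ x])
  moreover have "pd u (pd v Z) x = pd v (pd u Z) x" by (rule pd_commute[OF open_S smooth_Z x])
  moreover have cG: "pd a (pd ?\<zeta> (\<lambda>y. Gam y b d)) x = pd ?\<zeta> (pd a (\<lambda>y. Gam y b d)) x" for a b d
    by (rule pd_commute[OF open_S smooth_Gam x])
  ultimately have "pd u (pd (Gam x v w) Z) x + ?J (pd u (\<lambda>y. Gam y v w) x)
      - (pd ?\<zeta> (pd u (\<lambda>y. Gam y v w)) x + pd (?J u) (\<lambda>y. Gam y v w) x)
      - pd u (\<lambda>y. Gam y (?J v) w) x
      - (pd u (\<lambda>y. Gam y v (?J w)) x + Gam x v (pd u (pd w Z) x))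
    = pd v (pd (Gam x u w) Z) x + ?J (pd v (\<lambda>y. Gam y u w) x)
      - (pd ?\<zeta> (pd v (\<lambda>y. Gam y u w)) x + pd (?J v) (\<lambda>y. Gam y u w) x)
      - pd v (\<lambda>y. Gam y (?J u) w) x
      - (pd v (\<lambda>y. Gam y u (?J w)) x + Gam x u (pd v (pd w Z) x))"
    using *[of u v] *[of v u] by (simp add: algebra_simps)
  then show ?thesis
    unfolding pd_Rm[OF x]
    unfolding riemann_pd lie_Gam[OF x]
    by (simp add: Gam_simps[OF x] linear_add[OF J] linear_diff[OF J] algebra_simps)
qed

text \<open>The trace of \<open>lie_Rm\<close>: the derivative of \<open>Z\<close> acting on the
  value and the one acting in the traced slot cancel.\<close>

lemma lie_Ric:
  assumes x: "x \<in> S"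
  shows "pd (Z x) (\<lambda>y. Ric y v w) x + Ric x (pd v Z x) w + Ric x v (pd w Z x) = 0"
proof -
  have "(\<Sum>b\<in>Basis. pd (Rm x b v w) Z x \<bullet> b) = (\<Sum>b\<in>Basis. Rm x (pd b Z x) v w \<bullet> b)"
    by (rule sum_trace_commute[OF linear_pd[OF smooth_Z x] linear_Rm(1)[OF x]])
  then show ?thesis
    unfolding pd_Ric[OF x] lie_Rm[OF x]
    by (simp add: ricci_def inner_diff_left inner_add_left sum.distrib sum_subtractf)
qed

text \<open>Since \<open>[Z,Z] = 0\<close>, this derivative is the Lie derivative of
  \<open>Ric\<close> evaluated on \<open>(Z, Z)\<close>.\<close>

lemma Ric_Z_Z_invariant: "x \<in> S \<Longrightarrow> pd (Z x) (\<lambda>y. Ric y (Z y) (Z y)) x = 0"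
  using pd_bilinear_family[OF open_S bilinear_Ric smooth_Ric smooth_Z smooth_Z, of x "Z x"]
    lie_Ric[of x "Z x" "Z x"] by simp

lemma G_Z_Z_invariant: "x \<in> S \<Longrightarrow> pd (Z x) (\<lambda>y. G y (Z y) (Z y)) x = 0"
  using pd_bilinear_family[OF open_S bilin smooth smooth_Z smooth_Z, of x "Z x"]
    killing_pd[of x "Z x" "Z x"] by simp

text \<open>A flow preserving the connection and \<open>Z\<close> preserves
  \<open>\<nabla>\<^sub>Z Z\<close>; infinitesimally, this field commutes with
  \<open>Z\<close>.\<close>

lemma geodesic_curvature_invariant:
  assumes x: "x \<in> S"
  shows "pd (Z x) (\<lambda>y. pd (Z y) Z y + Gam y (Z y) (Z y)) x = pd (pd (Z x) Z x + Gam x (Z x) (Z x)) Z x"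
proof -
  have "pd (Z x) (\<lambda>y. pd (Z y) Z y + Gam y (Z y) (Z y)) x
      = pd (Z x) (\<lambda>y. pd (Z y) Z y) x + pd (Z x) (\<lambda>y. Gam y (Z y) (Z y)) x"
    by (intro pd_add[OF _ _ x] smooth_on_pd_along smooth_Gam_fields smooth_Z open_S)
  then show ?thesis
    by (simp add: pd_pd_along[OF open_S smooth_Z smooth_Z x] pd_Gam_fields[OF smooth_Z smooth_Z x]
        lie_Gam[OF x] linear_add[OF linear_pd[OF smooth_Z x]])
qed

end

section \<open>Warped products in a chart\<close>

text \<open>Here \<open>F\<close> stands for the square of the warping function, which makes the
  metric linear in \<open>F\<close>.\<close>

definition warp :: "('a \<Rightarrow> real) \<Rightarrow> ('a \<Rightarrow> 'a \<Rightarrow> 'a \<Rightarrow> real) \<Rightarrow> ('b \<Rightarrow> 'b \<Rightarrow> 'b \<Rightarrow> real)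
    \<Rightarrow> 'a \<times> 'b \<Rightarrow> 'a \<times> 'b \<Rightarrow> 'a \<times> 'b \<Rightarrow> real" where
  "warp F G1 G2 z v w = G1 (fst z) (fst v) (fst w) + F (fst z) * G2 (snd z) (snd v) (snd w)"

lemma sum_Basis_prod:
  fixes f :: "'a::euclidean_space \<times> 'b::euclidean_space \<Rightarrow> 'c::comm_monoid_add"
  shows "(\<Sum>b\<in>Basis. f b) = (\<Sum>i\<in>Basis. f (i, 0)) + (\<Sum>j\<in>Basis. f (0, j))"
proof -
  have "inj_on (\<lambda>i. (i, 0::'b)) (Basis :: 'a set)" "inj_on (\<lambda>j. (0::'a, j)) (Basis :: 'b set)"
    by (auto intro: inj_onI)
  then show ?thesis
    unfolding Basis_prod_def
    by (subst sum.union_disjoint) (auto simp: sum.reindex)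
qed

locale local_warped = M1: local_metric S1 G1 + M2: local_metric S2 G2
  for S1 :: "'a::euclidean_space set" and G1
    and S2 :: "'b::euclidean_space set" and G2 +
  fixes F :: "'a \<Rightarrow> real"
  assumes smooth_F: "smooth_on S1 F" and F_pos: "x \<in> S1 \<Longrightarrow> F x > 0"
begin

abbreviation "W \<equiv> warp F G1 G2"

lemma open_Times_S: "open (S1 \<times> S2)"
  by (simp add: open_Times M1.open_S M2.open_S)

lemma smooth_on_fst: "smooth_on S1 h \<Longrightarrow> smooth_on (S1 \<times> S2) (\<lambda>z. h (fst z))"
  by (rule smooth_on_compose_linear[OF open_Times_S bounded_linear_fst]) auto

lemma smooth_on_snd: "smooth_on S2 h \<Longrightarrow> smooth_on (S1 \<times> S2) (\<lambda>z. h (snd z))"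
  by (rule smooth_on_compose_linear[OF open_Times_S bounded_linear_snd]) auto

lemma pd_fst: "smooth_on S1 h \<Longrightarrow> z \<in> S1 \<times> S2 \<Longrightarrow> pd v (\<lambda>z. h (fst z)) z = pd (fst v) h (fst z)"
  by (rule pd_compose_linear[OF bounded_linear_fst]) auto

lemma pd_snd: "smooth_on S2 h \<Longrightarrow> z \<in> S1 \<times> S2 \<Longrightarrow> pd v (\<lambda>z. h (snd z)) z = pd (snd v) h (snd z)"
  by (rule pd_compose_linear[OF bounded_linear_snd]) auto

lemma smooth_W: "smooth_on (S1 \<times> S2) (\<lambda>z. W z v w)"
  unfolding warp_def
  by (intro smooth_on_add smooth_on_mult open_Times_S smooth_on_fst[OF M1.smooth]
      smooth_on_fst[OF smooth_F] smooth_on_snd[OF M2.smooth])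

lemma pd_W:
  assumes "z \<in> S1 \<times> S2"
  shows "pd p (\<lambda>z. W z v w) z = pd (fst p) (\<lambda>x. G1 x (fst v) (fst w)) (fst z)
    + (F (fst z) * pd (snd p) (\<lambda>y. G2 y (snd v) (snd w)) (snd z)
      + pd (fst p) F (fst z) * G2 (snd z) (snd v) (snd w))"
  unfolding warp_def
  by (simp add: pd_add[OF _ _ assms] smooth_on_mult[OF open_Times_S] smooth_on_fst[OF M1.smooth]
      smooth_on_fst[OF smooth_F] smooth_on_snd[OF M2.smooth] pd_mult[OF _ _ assms]
      pd_fst[OF M1.smooth assms] pd_fst[OF smooth_F assms] pd_snd[OF M2.smooth assms])

lemma local_metric_W: "local_metric (S1 \<times> S2) W"
proof
  fix z v w assume z: "z \<in> S1 \<times> S2"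
  then have x: "fst z \<in> S1" and y: "snd z \<in> S2" by auto
  show "bilinear (W z)"
    unfolding bilinear_def
    by (auto intro!: linearI simp: warp_def M1.G_simps[OF x] M2.G_simps[OF y] algebra_simps)
  show "W z v w = W z w v"
    by (simp add: warp_def M1.sym[OF x, of "fst v"] M2.sym[OF y, of "snd v"])
next
  fix z v assume z: "z \<in> S1 \<times> S2" and v: "\<And>w. W z v w = 0"
  then have x: "fst z \<in> S1" and y: "snd z \<in> S2" by auto
  have "G1 (fst z) (fst v) w = 0" for w
    using v[of "(w, 0)"] by (simp add: warp_def M2.G_simps[OF y])
  moreover have "G2 (snd z) (snd v) w = 0" for w
    using v[of "(0, w)"] F_pos[OF x] by (simp add: warp_def M1.G_simps[OF x])
  ultimately show "v = 0" using M1.nondeg[OF x] M2.nondeg[OF y] by (simp add: prod_eq_iff)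
qed (rule open_Times_S smooth_W)+

end

sublocale local_warped \<subseteq> M: local_metric "S1 \<times> S2" W
  by (rule local_metric_W)

section \<open>Connection and Ricci curvature of the warped product\<close>

context local_warped
begin

definition grad :: "'a \<Rightarrow> 'a" where
  "grad x = (THE u. \<forall>v. G1 x u v = pd v F x)"

lemma G1_grad: "x \<in> S1 \<Longrightarrow> G1 x (grad x) v = pd v F x"
  using theI'[OF M1.G_represents[OF _ linear_pd[OF smooth_F]]] by (simp add: grad_def)

text \<open>O'Neill's formulas in terms of \<open>F = f^2\<close>: \<open>dF / (2 F)\<close> is the
  differential of \<open>ln f\<close>, and half of \<open>grad\<close> is \<open>f\<close> times the
  gradient of \<open>f\<close>. The vector is checked against the Koszul formula.\<close>

lemma Gam_W:
  assumes z: "z \<in> S1 \<times> S2"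
  shows "M.Gam z v w =
    (M1.Gam (fst z) (fst v) (fst w) - (G2 (snd z) (snd v) (snd w) / 2) *\<^sub>R grad (fst z),
     M2.Gam (snd z) (snd v) (snd w) + (pd (fst v) F (fst z) / (2 * F (fst z))) *\<^sub>R snd w
       + (pd (fst w) F (fst z) / (2 * F (fst z))) *\<^sub>R snd v)"
proof (rule M.levi_civita_eqI[OF z])
  fix p
  have x: "fst z \<in> S1" and y: "snd z \<in> S2" using z by auto
  define \<alpha> where "\<alpha> u = pd u F (fst z) / (2 * F (fst z))" for u
  have \<alpha>: "2 * (F (fst z) * \<alpha> u) = pd u F (fst z)" for u
    using F_pos[OF x] by (simp add: \<alpha>_def)
  have "2 * W z (M1.Gam (fst z) (fst v) (fst w) - (G2 (snd z) (snd v) (snd w) / 2) *\<^sub>R grad (fst z),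
     M2.Gam (snd z) (snd v) (snd w) + \<alpha> (fst v) *\<^sub>R snd w + \<alpha> (fst w) *\<^sub>R snd v) p
    = 2 * G1 (fst z) (M1.Gam (fst z) (fst v) (fst w)) (fst p)
      - G2 (snd z) (snd v) (snd w) * pd (fst p) F (fst z)
      + F (fst z) * (2 * G2 (snd z) (M2.Gam (snd z) (snd v) (snd w)) (snd p))
      + 2 * (F (fst z) * \<alpha> (fst v)) * G2 (snd z) (snd w) (snd p)
      + 2 * (F (fst z) * \<alpha> (fst w)) * G2 (snd z) (snd v) (snd p)"
    by (simp add: warp_def M1.G_simps[OF x] M2.G_simps[OF y] G1_grad[OF x] algebra_simps)
  also have "\<dots> = M.koszul z v w p"
    unfolding \<alpha> M1.G_levi_civita[OF x] M2.G_levi_civita[OF y] pd_W[OF z]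
    by (simp add: algebra_simps)
  finally show "2 * W z (M1.Gam (fst z) (fst v) (fst w) - (G2 (snd z) (snd v) (snd w) / 2) *\<^sub>R grad (fst z),
     M2.Gam (snd z) (snd v) (snd w) + (pd (fst v) F (fst z) / (2 * F (fst z))) *\<^sub>R snd w
       + (pd (fst w) F (fst z) / (2 * F (fst z))) *\<^sub>R snd v) p = M.koszul z v w p"
    unfolding \<alpha>_def .
qed

lemma Gam_W_hor:
  "z \<in> S1 \<times> S2 \<Longrightarrow> M.Gam z (v, 0) (w, 0) = (M1.Gam (fst z) v w, 0)"
  by (auto simp: Gam_W M2.G_simps linear_0[OF M2.linear_Gam(1)])

lemma Gam_W_mixed:
  "z \<in> S1 \<times> S2 \<Longrightarrow> M.Gam z (v, 0) (0, b) = (0, (pd v F (fst z) / (2 * F (fst z))) *\<^sub>R b)"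
  "z \<in> S1 \<times> S2 \<Longrightarrow> M.Gam z (0, b) (v, 0) = (0, (pd v F (fst z) / (2 * F (fst z))) *\<^sub>R b)"
  by (auto simp: Gam_W M2.G_simps linear_0[OF M2.linear_Gam(1)] linear_0[OF M2.linear_Gam(2)]
      linear_0[OF M1.linear_Gam(1)] linear_0[OF M1.linear_Gam(2)] linear_0[OF linear_pd[OF smooth_F]])

lemma smooth_inverse_F: "smooth_on S1 (\<lambda>x. inverse (2 * F x))"
  using F_pos
  by (intro smooth_on_inverse smooth_on_linear_image[OF _ bounded_linear_mult_right] M1.open_S smooth_F) force

lemma smooth_dF_F: "smooth_on S1 (\<lambda>x. pd w F x / (2 * F x))"
  unfolding divide_inverse
  by (intro smooth_on_mult smooth_inverse_F smooth_on_pd smooth_F M1.open_S)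

lemma pd_dF_F:
  assumes x: "x \<in> S1"
  shows "pd v (\<lambda>x. pd w F x / (2 * F x)) x
    = pd v (pd w F) x / (2 * F x) - pd v F x * pd w F x / (2 * (F x)\<^sup>2)"
proof -
  have F: "2 * F x \<noteq> 0" using F_pos[OF x] by simp
  have "((\<lambda>x. pd w F x / (2 * F x)) has_derivative
      (\<lambda>v. (pd v (pd w F) x * (2 * F x) - pd w F x * (2 * pd v F x)) / (2 * F x * (2 * F x)))) (at x)"
    by (rule has_derivative_divide'[of "\<lambda>x. pd w F x" _ x UNIV "\<lambda>x. 2 * F x"])
      (use F in \<open>auto intro!: derivative_eq_intros smooth_on_has_derivative[OF smooth_F x]
        smooth_on_has_derivative[OF smooth_on_pd[OF smooth_F] x]\<close>)
  from has_derivative_imp_pd[OF this, of v] show ?thesis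
    using F by (simp add: field_simps power2_eq_square)
qed

text \<open>The bracket is the Hessian of \<open>f\<close> divided by \<open>f\<close>, rewritten
  with \<open>F = f^2\<close>. Every fibre direction contributes the same amount to the trace,
  whence the factor \<open>DIM('b)\<close>.\<close>

lemma Ric_W_horizontal:
  assumes z: "z \<in> S1 \<times> S2"
  shows "M.Ric z (v, 0) (w, 0) = M1.Ric (fst z) v w - DIM('b) *
    ((pd v (pd w F) (fst z) - pd (M1.Gam (fst z) v w) F (fst z)) / (2 * F (fst z))
      - pd v F (fst z) * pd w F (fst z) / (4 * (F (fst z))\<^sup>2))"
proof -
  let ?x = "fst z"
  let ?Q = "(pd v (pd w F) ?x - pd (M1.Gam ?x v w) F ?x) / (2 * F ?x)
      - pd v F ?x * pd w F ?x / (4 * (F ?x)\<^sup>2)"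
  have x: "?x \<in> S1" using z by auto
  have F: "F ?x \<noteq> 0" using F_pos[OF x] by simp
  have hor: "pd p (\<lambda>z. M.Gam z (a, 0) (w, 0)) z = (pd (fst p) (\<lambda>x. M1.Gam x a w) ?x, 0)" for p a
  proof -
    have "pd p (\<lambda>z. M.Gam z (a, 0) (w, 0)) z = pd p (\<lambda>z. (M1.Gam (fst z) a w, 0)) z"
      by (rule pd_cong[OF open_Times_S z Gam_W_hor])
    also have "\<dots> = (pd p (\<lambda>z. M1.Gam (fst z) a w) z, 0)"
      by (rule pd_linear_image[OF bounded_linear_Pair[OF bounded_linear_ident bounded_linear_zero]
            smooth_on_fst[OF M1.smooth_Gam] z])
    finally show ?thesis by (simp add: pd_fst[OF M1.smooth_Gam z])
  qed
  have ver: "pd (v, 0) (\<lambda>z. M.Gam z (0, b) (w, 0)) z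
      = (0, (pd v (pd w F) ?x / (2 * F ?x) - pd v F ?x * pd w F ?x / (2 * (F ?x)\<^sup>2)) *\<^sub>R b)" for b
  proof -
    have "pd (v, 0) (\<lambda>z. M.Gam z (0, b) (w, 0)) z
        = pd (v, 0) (\<lambda>z. (0, (pd w F (fst z) / (2 * F (fst z))) *\<^sub>R b)) z"
      by (rule pd_cong[OF open_Times_S z Gam_W_mixed(2)])
    also have "\<dots> = (0, pd (v, 0) (\<lambda>z. pd w F (fst z) / (2 * F (fst z))) z *\<^sub>R b)"
      by (rule pd_linear_image[OF bounded_linear_Pair[OF bounded_linear_zero bounded_linear_scaleR_left]
            smooth_on_fst[OF smooth_dF_F] z])
    finally show ?thesis by (simp add: pd_fst[OF smooth_dF_F z] pd_dF_F[OF x])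
  qed
  have "M.Rm z (b, 0) (v, 0) (w, 0) = (M1.Rm ?x b v w, 0)" for b
    unfolding M.riemann_pd M1.riemann_pd hor Gam_W_hor[OF z] by simp
  moreover have "M.Rm z (0, b) (v, 0) (w, 0) = (0, - ?Q *\<^sub>R b)" for b
    unfolding M.riemann_pd hor ver Gam_W_hor[OF z] Gam_W_mixed[OF z]
    using F by (simp add: linear_0[OF linear_pd[OF M1.smooth_Gam x]] flip: scaleR_left_diff_distrib scaleR_minus_left)
      (simp add: field_simps power2_eq_square)
  ultimately show ?thesis
    by (simp add: ricci_def sum_Basis_prod inner_Basis) (simp add: algebra_simps)
qed

lemma lie_metric_warp:
  assumes X: "smooth_on S1 X" and Y: "smooth_on S2 Y" and z: "z \<in> S1 \<times> S2"
  shows "lie_metric (\<lambda>z. (X (fst z), Y (snd z))) W z v w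
    = lie_metric X G1 (fst z) (fst v) (fst w)
      + pd (X (fst z)) F (fst z) * G2 (snd z) (snd v) (snd w)
      + F (fst z) * lie_metric Y G2 (snd z) (snd v) (snd w)"
proof -
  have "((\<lambda>z. (X (fst z), Y (snd z))) has_derivative
      (\<lambda>v. (pd (fst v) X (fst z), pd (snd v) Y (snd z)))) (at z)"
    using z
    by (intro has_derivative_Pair
        has_derivative_compose[OF has_derivative_fst[OF has_derivative_ident] smooth_on_has_derivative[OF X]]
        has_derivative_compose[OF has_derivative_snd[OF has_derivative_ident] smooth_on_has_derivative[OF Y]]) auto
  from has_derivative_imp_pd[OF this]
  have "pd p (\<lambda>z. (X (fst z), Y (snd z))) z = (pd (fst p) X (fst z), pd (snd p) Y (snd z))" for p .
  then show ?thesis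
    unfolding lie_metric_def pd_def[symmetric] pd_W[OF z] by (simp add: warp_def algebra_simps)
qed

text \<open>The metric \<open>W\<close> is parallel, so \<open>c * W\<close> drops out. What remains
  is the derivative of \<open>\<phi>\<close> and the failure of \<open>G2\<close> to be parallel for
  the warped connection.\<close>

lemma cov_Ric_W:
  assumes Ric: "\<And>z v w. z \<in> S1 \<times> S2 \<Longrightarrow> M.Ric z v w = c * W z v w - \<phi> (fst z) * G2 (snd z) (snd v) (snd w)"
    and \<phi>: "smooth_on S1 \<phi>" and z: "z \<in> S1 \<times> S2"
  shows "M.cov_Ric z a v w = \<phi> (fst z) / (2 * F (fst z)) *
      (2 * pd (fst a) F (fst z) * G2 (snd z) (snd v) (snd w)
        + pd (fst v) F (fst z) * G2 (snd z) (snd a) (snd w)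
        + pd (fst w) F (fst z) * G2 (snd z) (snd v) (snd a))
    - pd (fst a) \<phi> (fst z) * G2 (snd z) (snd v) (snd w)"
proof -
  have y: "snd z \<in> S2" and x: "fst z \<in> S1" using z by auto
  have F: "F (fst z) \<noteq> 0" using F_pos[OF x] by simp
  define \<alpha> where "\<alpha> p = pd (fst p) F (fst z) / (2 * F (fst z))" for p :: "'a \<times> 'b"
  have "pd a (\<lambda>z. M.Ric z v w) z = pd a (\<lambda>z. c * W z v w - \<phi> (fst z) * G2 (snd z) (snd v) (snd w)) z"
    by (rule pd_cong[OF open_Times_S z Ric])
  also have "\<dots> = c * pd a (\<lambda>z. W z v w) z - (\<phi> (fst z) * pd (snd a) (\<lambda>y. G2 y (snd v) (snd w)) (snd z)
      + pd (fst a) \<phi> (fst z) * G2 (snd z) (snd v) (snd w))"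
    by (simp add: pd_diff[OF _ _ z] smooth_on_linear_image[OF open_Times_S bounded_linear_mult_right smooth_W]
        smooth_on_mult[OF open_Times_S] smooth_on_fst[OF \<phi>] smooth_on_snd[OF M2.smooth]
        pd_linear_image[OF bounded_linear_mult_right smooth_W z] pd_mult[OF _ _ z]
        pd_fst[OF \<phi> z] pd_snd[OF M2.smooth z])
  finally have "M.cov_Ric z a v w = c * (pd a (\<lambda>z. W z v w) z - W z (M.Gam z a v) w - W z v (M.Gam z a w))
      - \<phi> (fst z) * (pd (snd a) (\<lambda>y. G2 y (snd v) (snd w)) (snd z)
          - G2 (snd z) (snd (M.Gam z a v)) (snd w) - G2 (snd z) (snd v) (snd (M.Gam z a w)))
      - pd (fst a) \<phi> (fst z) * G2 (snd z) (snd v) (snd w)"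
    unfolding M.cov_Ric_def Ric[OF z] by (simp add: algebra_simps)
  moreover have "snd (M.Gam z p q) = M2.Gam (snd z) (snd p) (snd q) + \<alpha> p *\<^sub>R snd q + \<alpha> q *\<^sub>R snd p" for p q
    by (simp add: Gam_W[OF z] \<alpha>_def)
  ultimately have "M.cov_Ric z a v w = \<phi> (fst z) * (2 * \<alpha> a * G2 (snd z) (snd v) (snd w)
        + \<alpha> v * G2 (snd z) (snd a) (snd w) + \<alpha> w * G2 (snd z) (snd v) (snd a))
      - pd (fst a) \<phi> (fst z) * G2 (snd z) (snd v) (snd w)"
    by (simp add: M.metric_compat[OF z] M2.metric_compat[OF y] M2.G_simps[OF y] algebra_simps)
  then show ?thesis using F by (simp add: \<alpha>_def field_simps)
qed

text \<open>On the fibre the inverse of \<open>W\<close> is that of \<open>G2\<close> divided by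
  \<open>F\<close>, so the trace of \<open>G2\<close> with respect to \<open>W\<close> is the fibre
  dimension over \<open>F\<close>.\<close>

lemma G2_sharp:
  assumes z: "z \<in> S1 \<times> S2"
  shows "G2 (snd z) b (snd (M.sharp z (0, b))) = (b \<bullet> b) / F (fst z)"
    "G2 (snd z) (snd (M.sharp z (0, b))) b = (b \<bullet> b) / F (fst z)"
proof -
  have y: "snd z \<in> S2" and x: "fst z \<in> S1" using z by auto
  show "G2 (snd z) b (snd (M.sharp z (0, b))) = (b \<bullet> b) / F (fst z)"
    using M.G_sharp'[OF z, of "(0, b)" "(0, b)"] F_pos[OF x]
    by (simp add: warp_def M1.G_simps[OF x] field_simps)
  then show "G2 (snd z) (snd (M.sharp z (0, b))) b = (b \<bullet> b) / F (fst z)"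
    by (simp add: M2.sym[OF y, of _ b])
qed

text \<open>Both sides of the contracted Bianchi identity at a horizontal \<open>v\<close> contain
  \<open>n \<phi> dF(v) / F^2\<close>, with \<open>n\<close> the fibre dimension: on the left from
  differentiating the trace \<open>n / F\<close> of \<open>G2\<close>, on the right from its
  divergence. Cancelling leaves \<open>n d\<phi>(v) / F = 0\<close>.\<close>

lemma fibre_defect_constant:
  assumes Ric: "\<And>z v w. z \<in> S1 \<times> S2 \<Longrightarrow> M.Ric z v w = c * W z v w - \<phi> (fst z) * G2 (snd z) (snd v) (snd w)"
    and \<phi>: "smooth_on S1 \<phi>" and x: "x \<in> S1" and ne: "S2 \<noteq> {}"
  shows "pd v \<phi> x = 0"
proof -
  obtain y where y: "y \<in> S2" using ne by blast
  have z: "(x, y) \<in> S1 \<times> S2" using x y by simp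
  have F: "F x > 0" by (rule F_pos[OF x])
  have d0: "pd 0 h x = 0" if "smooth_on S1 h" for h :: "'a \<Rightarrow> real"
    by (rule linear_0[OF linear_pd[OF that x]])
  note simps = cov_Ric_W[OF Ric \<phi> z] sum_Basis_prod M2.G_simps[OF y] d0[OF smooth_F] d0[OF \<phi>]
    G2_sharp[OF z, simplified] inner_Basis
  have "DIM('b) * (\<phi> x / (2 * F x) * (2 * pd v F x / F x) - pd v \<phi> x / F x)
      = DIM('b) * (2 * (\<phi> x / (2 * F x) * (pd v F x / F x)))"
    using M.contracted_bianchi[OF z, of "(v, 0)"] by (simp add: simps)
  then show ?thesis using F by (simp add: field_simps)
qed

end

locale local_warped_killing = local_warped S1 G1 S2 G2 F + K: local_killing S1 G1 Z
  for S1 :: "'a::euclidean_space set" and G1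
    and S2 :: "'b::euclidean_space set" and G2 and F Z
begin

text \<open>Put \<open>k = Z(F)\<close>. Contracting the horizontal part of the soliton equation with \<open>Z\<close> twice gives
  \<open>4 F\<^sup>2 h = n (2 F e - k\<^sup>2)\<close>, where \<open>k\<close> is locally constant, \<open>n\<close> is the dimension of the fibre and
  \<open>h\<close>, \<open>e\<close> are \<open>Z\<close>-invariant. Differentiating along \<open>Z\<close> gives \<open>k\<^sup>3 = F k e\<close>,
  and once more \<open>k\<^sup>2 e = 0\<close>.\<close>

theorem killing_warping_invariant:
  assumes Ric: "\<And>z v w. z \<in> S1 \<times> S2 \<Longrightarrow>
      M.Ric z v w = c * W z v w - pd (Z (fst z)) F (fst z) / 2 * G2 (snd z) (snd v) (snd w)"
    and ne: "S2 \<noteq> {}" and x: "x \<in> S1"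
  shows "pd (Z x) F x = 0"
proof -
  note S = M1.open_S
  define k where "k x = pd (Z x) F x" for x
  define A where "A x = pd (Z x) Z x + M1.Gam x (Z x) (Z x)" for x
  \<comment> \<open>\<open>A\<close> is \<open>\<nabla>\<^sub>Z Z\<close>, and \<open>e\<close> is
    the Hessian of \<open>F\<close> on \<open>(Z, Z)\<close>: the other part \<open>Z(Z(F))\<close>
    vanishes because \<open>k\<close> is locally constant.\<close>
  define e where "e x = - pd (A x) F x" for x
  define h where "h x = M1.Ric x (Z x) (Z x) - c * G1 x (Z x) (Z x)" for x
  have sk: "smooth_on S1 k" unfolding k_def by (intro smooth_on_pd_along S smooth_F K.smooth_Z)
  have sA: "smooth_on S1 A"
    unfolding A_def by (intro smooth_on_add smooth_on_pd_along M1.smooth_Gam_fields S K.smooth_Z)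
  have se: "smooth_on S1 e"
    unfolding e_def by (intro smooth_on_minus smooth_on_pd_along sA smooth_F S)
  have sG: "smooth_on S1 (\<lambda>x. G1 x (Z x) (Z x))" by (intro M1.smooth_G_fields K.smooth_Z)
  have sR: "smooth_on S1 (\<lambda>x. M1.Ric x (Z x) (Z x))"
    by (rule smooth_on_bilinear_family[OF S M1.bilinear_Ric M1.smooth_Ric K.smooth_Z K.smooth_Z])
  have sh: "smooth_on S1 h"
    unfolding h_def by (intro smooth_on_diff smooth_on_linear_image[OF S bounded_linear_mult_right] sG sR S)
  have dk: "pd v k x = 0" if x: "x \<in> S1" for v x
  proof -
    have "pd v (\<lambda>x. k x / 2) x = 0"
      by (rule fibre_defect_constant[OF _ _ x ne, of c])
        (use Ric smooth_on_linear_image[OF S bounded_linear_divide sk] in \<open>auto simp: k_def\<close>)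
    then show ?thesis by (simp add: pd_linear_image[OF bounded_linear_divide sk x])
  qed
  have ddF: "pd v (pd (Z x) F) x = - pd (pd v Z x) F x" if x: "x \<in> S1" for v x
    using dk[OF x, of v] unfolding k_def by (simp add: pd_pd_along[OF S smooth_F K.smooth_Z x])
  have dh: "pd (Z x) h x = 0" if x: "x \<in> S1" for x
    unfolding h_def
    by (simp add: pd_diff[OF _ _ x] sR smooth_on_linear_image[OF S bounded_linear_mult_right sG]
        pd_linear_image[OF bounded_linear_mult_right sG x] K.Ric_Z_Z_invariant[OF x] K.G_Z_Z_invariant[OF x])
  \<comment> \<open>\<open>A\<close> commutes with \<open>Z\<close>, so
    \<open>Z(A(F)) = A(Z(F)) = A(k) = 0\<close>.\<close>
  have de: "pd (Z x) e x = 0" if x: "x \<in> S1" for x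
  proof -
    have "pd (Z x) A x = pd (A x) Z x"
      using K.geodesic_curvature_invariant[OF x] unfolding A_def .
    then have "pd (Z x) (\<lambda>x. pd (A x) F x) x = 0"
      using ddF[OF x, of "A x"] pd_commute[OF S smooth_F x, of "Z x" "A x"]
      by (simp add: pd_pd_along[OF S smooth_F sA x])
    then show ?thesis
      unfolding e_def
      by (simp add: pd_linear_image[OF bounded_linear_minus[OF bounded_linear_ident]
            smooth_on_pd_along[OF S smooth_F sA] x])
  qed
  have eq: "4 * (F x * (F x * h x)) = DIM('b) * (2 * (F x * e x) - k x * k x)" if x: "x \<in> S1" for x
  proof -
    obtain y where "y \<in> S2" using ne by blast
    with x have z: "(x, y) \<in> S1 \<times> S2" by simp
    have F: "F x > 0" by (rule F_pos[OF x])
    have "e x = pd (Z x) (pd (Z x) F) x - pd (M1.Gam x (Z x) (Z x)) F x"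
      unfolding e_def A_def ddF[OF x] by (simp add: linear_add[OF linear_pd[OF smooth_F x]])
    then have "h x = DIM('b) * (e x / (2 * F x) - k x * k x / (4 * (F x)\<^sup>2))"
      using Ric_W_horizontal[OF z, of "Z x" "Z x"] Ric[OF z, of "(Z x, 0)" "(Z x, 0)"] z
      by (simp add: h_def k_def warp_def M2.G_simps)
    then show ?thesis using F by (simp add: field_simps power2_eq_square)
  qed
  have eq2: "k x * (k x * k x) = F x * (k x * e x)" if x: "x \<in> S1" for x
  proof -
    have "pd (Z x) (\<lambda>x. 4 * (F x * (F x * h x))) x = pd (Z x) (\<lambda>x. DIM('b) * (2 * (F x * e x) - k x * k x)) x"
      by (rule pd_cong[OF S x eq])
    moreover have "pd (Z x) (\<lambda>x. 4 * (F x * (F x * h x))) x = 4 * (F x * (k x * h x) + k x * (F x * h x))"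
      using dh[OF x]
      by (simp add: pd_linear_image[OF bounded_linear_mult_right _ x] smooth_on_mult[OF S] smooth_F sh
          pd_mult[OF _ _ x] flip: k_def)
    moreover have "pd (Z x) (\<lambda>x. DIM('b) * (2 * (F x * e x) - k x * k x)) x = DIM('b) * (2 * (k x * e x))"
      using de[OF x] dk[OF x]
      by (simp add: pd_linear_image[OF bounded_linear_mult_right _ x] smooth_on_mult[OF S]
          smooth_on_diff[OF S] smooth_on_linear_image[OF S bounded_linear_mult_right] smooth_F se sk
          pd_mult[OF _ _ x] pd_diff[OF _ _ x] flip: k_def)
    ultimately have "4 * (k x * (F x * h x)) = DIM('b) * (k x * e x)" by (simp add: algebra_simps)
    \<comment> \<open>Multiplication by \<open>F x\<close> produces the left side of
      \<open>eq\<close>, which eliminates \<open>h\<close>.\<close>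
    then have "F x * (DIM('b) * (k x * e x)) = k x * (4 * (F x * (F x * h x)))" by (auto simp: algebra_simps)
    then have "DIM('b) * (F x * (k x * e x)) = DIM('b) * (k x * (2 * (F x * e x) - k x * k x))"
      unfolding eq[OF x] by (simp add: algebra_simps)
    \<comment> \<open>The fibre dimension is positive and cancels.\<close>
    then have "F x * (k x * e x) = k x * (2 * (F x * e x) - k x * k x)" by simp
    then show ?thesis by (simp add: algebra_simps)
  qed
  have "pd (Z x) (\<lambda>x. k x * (k x * k x)) x = pd (Z x) (\<lambda>x. F x * (k x * e x)) x"
    by (rule pd_cong[OF S x eq2])
  then have "k x * (k x * e x) = 0"
    using de[OF x] dk[OF x]
    by (simp add: pd_mult[OF _ _ x] smooth_on_mult[OF S] smooth_F se sk flip: k_def)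
  \<comment> \<open>If \<open>k x\<close> were nonzero, \<open>e x\<close> would vanish, and
    \<open>eq2\<close> would give a vanishing cube.\<close>
  then have "k x = 0" using eq2[OF x] by auto
  then show ?thesis by (simp add: k_def)
qed

end

section \<open>Warped product solitons\<close>

text \<open>A field vanishing on an open set has zero derivative there. This handles the absent
  component of \<open>\<zeta>\<close> in cases (2) and (3).\<close>

lemma (in local_metric) lie_metric_zero_field:
  assumes "\<And>x. x \<in> S \<Longrightarrow> X x = 0" and x: "x \<in> S"
  shows "lie_metric X G x v w = 0"
proof -
  have "pd u X x = 0" for u
    using pd_cong[OF open_S x assms(1), where v = u] by (simp add: pd_const)
  then show ?thesis
    by (simp add: lie_metric_def assms flip: pd_def)
      (simp add: G_simps[OF x] linear_0[OF linear_pd[OF smooth x]])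
qed

section \<open>From a single chart to the manifold\<close>

lemma local_metric_chart:
  assumes "pseudo_riemannian A g" "i \<in> charts A"
  shows "local_metric (chart_img A i) (g i)"
  using assms by unfold_locales (auto simp: pseudo_riemannian_def smooth_manifold_def)

lemma local_warped_chart:
  assumes "pseudo_riemannian A g1" "pseudo_riemannian B g2"
    and f: "smooth_function A f" "\<forall>p\<in>carrier A. f p > 0"
    and i: "i \<in> charts A" and j: "j \<in> charts B"
  shows "local_warped (chart_img A i) (g1 i) (chart_img B j) (g2 j) (\<lambda>x. (f (chart_inv A i x))\<^sup>2)"
proof -
  interpret A: local_metric "chart_img A i" "g1 i" by (rule local_metric_chart[OF assms(1) i])
  interpret B: local_metric "chart_img B j" "g2 j" by (rule local_metric_chart[OF assms(2) j])
  show ?thesis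
  proof
    show "smooth_on (chart_img A i) (\<lambda>x. (f (chart_inv A i x))\<^sup>2)"
      unfolding power2_eq_square
      using f(1) i by (auto simp: smooth_function_def intro!: smooth_on_mult A.open_S)
    show "(f (chart_inv A i x))\<^sup>2 > 0" if "x \<in> chart_img A i" for x
      using f(2) i chart_inv_in[OF that] by (fastforce simp: carrier_def)
  qed
qed

lemma einstein_if_const:
  assumes g: "pseudo_riemannian A g"
    and "\<And>i x v w. i \<in> charts A \<Longrightarrow> x \<in> chart_img A i \<Longrightarrow> ricci (g i) x v w = c * g i x v w"
  shows "einstein A g"
  unfolding einstein_def einstein_with_factor_def
  using assms by (intro exI[of _ "\<lambda>_. c"])
    (auto simp: smooth_function_def pseudo_riemannian_def intro!: smooth_on_const open_chart_img)

lemma smooth_function_fst: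
  assumes A: "smooth_manifold A" and B: "smooth_manifold B" and h: "smooth_function A h"
  shows "smooth_function (prod_atlas A B) (\<lambda>p. h (fst p))"
  unfolding smooth_function_def prod_atlas_simps
proof
  fix k assume k: "k \<in> charts A \<times> charts B"
  let ?U = "chart_img A (fst k) \<times> chart_img B (snd k)"
  have U: "open ?U" using k A B by (auto intro!: open_Times open_chart_img)
  have "smooth_on ?U (\<lambda>z. h (chart_inv A (fst k) (fst z)))"
    by (rule smooth_on_compose_linear[OF U bounded_linear_fst, of "chart_img A (fst k)"])
      (use h k in \<open>auto simp: smooth_function_def\<close>)
  then show "smooth_on ?U (\<lambda>z. h (fst (chart_inv (prod_atlas A B) k z)))"
    by (rule smooth_on_cong[OF U, THEN iffD1, rotated]) (simp add: prod_chart_inv[OF A B k])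
qed

theorem theorem2:
  fixes M1 :: "('i, 'm::{t2_space, second_countable_topology}, 'd::euclidean_space) atlas"
    and M2 :: "('j, 'n::{t2_space, second_countable_topology}, 'e::euclidean_space) atlas"
    and g1 :: "('i, 'd) tensor2" and g2 :: "('j, 'e) tensor2"
    and f :: "'m \<Rightarrow> real"
    and \<zeta>1 :: "('i, 'd) vfield" and \<zeta>2 :: "('j, 'e) vfield"
    and \<zeta> :: "('i \<times> 'j, 'd \<times> 'e) vfield"
    and c :: real
  assumes "pseudo_riemannian M1 g1" and "pseudo_riemannian M2 g2"
    and "smooth_function M1 f" and "\<forall>p\<in>carrier M1. f p > 0"
    and "vector_field M1 \<zeta>1" and "vector_field M2 \<zeta>2"
    and "\<zeta> = add_vf (lift1 \<zeta>1) (lift2 \<zeta>2)"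
    and "ricci_soliton (prod_atlas M1 M2) (warped_metric M1 f g1 g2) \<zeta> c"
    and "(\<exists>\<rho>1 \<rho>2. conformal_field M1 g1 \<zeta>1 \<rho>1 \<and> conformal_field M2 g2 \<zeta>2 \<rho>2 \<and>
            (\<forall>p\<in>carrier M1. \<forall>q\<in>carrier M2.
               \<rho>1 p = \<rho>2 q + vf_act M1 \<zeta>1 (\<lambda>x. ln (f x)) p))
       \<or> (eq_vf (prod_atlas M1 M2) \<zeta> (lift1 \<zeta>1) \<and> killing_field M1 g1 \<zeta>1)
       \<or> (eq_vf (prod_atlas M1 M2) \<zeta> (lift2 \<zeta>2) \<and> killing_field M2 g2 \<zeta>2)
       \<or> (killing_field M1 g1 \<zeta>1 \<and> killing_field M2 g2 \<zeta>2 \<and>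
            (\<forall>p\<in>carrier M1. vf_act M1 \<zeta>1 f p = 0))"
  shows "einstein (prod_atlas M1 M2) (warped_metric M1 f g1 g2)"
proof -
  note g1 = assms(1) and g2 = assms(2) and f = assms(3,4) and X = assms(5) and Y = assms(6)
    and zeta = assms(7) and soliton = assms(8)
  have A: "smooth_manifold M1" and B: "smooth_manifold M2"
    using g1 g2 by (auto simp: pseudo_riemannian_def)
  let ?M = "prod_atlas M1 M2" and ?g = "warped_metric M1 f g1 g2"
  let ?f = "\<lambda>i x. f (chart_inv M1 i x)"
  have g: "pseudo_riemannian ?M ?g" by (rule pseudo_riemannian_warped[OF g1 g2 f])
  have fpos: "?f i x > 0" if "i \<in> charts M1" "x \<in> chart_img M1 i" for i x
    using f(2) that chart_inv_in[of x M1 i] by (auto simp: carrier_def)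
  have sf: "smooth_on (chart_img M1 i) (?f i)" if "i \<in> charts M1" for i
    using f(1) that by (auto simp: smooth_function_def)
  have act: "vf_act M1 \<zeta>1 h (chart_inv M1 i x) = pd (\<zeta>1 i x) (\<lambda>y. h (chart_inv M1 i y)) x"
    if "smooth_function M1 h" "i \<in> charts M1" "x \<in> chart_img M1 i" for h i x
    using vf_act_chart[OF A X that(1,2) chart_inv_in[OF that(3)]]
    by (simp add: chart_map_inv[OF A that(2,3)] pd_def)
  have warp: "?g (i, j) = warp (\<lambda>x. (?f i x)\<^sup>2) (g1 i) (g2 j)" for i j
    by (simp add: warped_metric_def warp_def fun_eq_iff)
  have zeta_chart: "\<zeta> (i, j) = (\<lambda>z. (\<zeta>1 i (fst z), \<zeta>2 j (snd z)))" for i j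
    by (simp add: zeta add_vf_def lift1_def lift2_def)
  have pdF: "pd v (\<lambda>x. (?f i x)\<^sup>2) x = 2 * ?f i x * pd v (?f i) x"
    if "i \<in> charts M1" "x \<in> chart_img M1 i" for i v x
    unfolding power2_eq_square using pd_mult[OF sf[OF that(1)] sf[OF that(1)] that(2), of v] by simp
  have sol: "1/2 * lie_metric (\<zeta> k) (?g k) z v w + ricci (?g k) z v w = c * ?g k z v w"
    if "k \<in> charts ?M" "z \<in> chart_img ?M k" for k z v w
    using soliton that unfolding ricci_soliton_def by blast
  have eq: "1/2 * (lie_metric (\<zeta>1 i) (g1 i) x (fst v) (fst w)
        + pd (\<zeta>1 i x) (\<lambda>x. (?f i x)\<^sup>2) x * g2 j y (snd v) (snd w)
        + (?f i x)\<^sup>2 * lie_metric (\<zeta>2 j) (g2 j) y (snd v) (snd w))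
      + ricci (?g (i, j)) (x, y) v w = c * ?g (i, j) (x, y) v w"
    if "i \<in> charts M1" "j \<in> charts M2" "x \<in> chart_img M1 i" "y \<in> chart_img M2 j" for i j x y v w
  proof -
    interpret local_warped "chart_img M1 i" "g1 i" "chart_img M2 j" "g2 j" "\<lambda>x. (?f i x)\<^sup>2"
      by (rule local_warped_chart[OF g1 g2 f that(1,2)])
    have "1/2 * lie_metric (\<zeta> (i, j)) (?g (i, j)) (x, y) v w + ricci (?g (i, j)) (x, y) v w
        = c * ?g (i, j) (x, y) v w"
      by (rule sol) (use that in auto)
    moreover have "lie_metric (\<zeta> (i, j)) (?g (i, j)) (x, y) v w
        = lie_metric (\<zeta>1 i) (g1 i) x (fst v) (fst w)
        + pd (\<zeta>1 i x) (\<lambda>x. (?f i x)\<^sup>2) x * g2 j y (snd v) (snd w)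
        + (?f i x)\<^sup>2 * lie_metric (\<zeta>2 j) (g2 j) y (snd v) (snd w)"
      unfolding zeta_chart warp
      using lie_metric_warp[of "\<zeta>1 i" "\<zeta>2 j" "(x, y)" v w] X Y that by (simp add: vector_field_def)
    ultimately show ?thesis by simp
  qed
  consider (conformal) \<rho>1 \<rho>2 where "conformal_field M1 g1 \<zeta>1 \<rho>1" "conformal_field M2 g2 \<zeta>2 \<rho>2"
      "\<forall>p\<in>carrier M1. \<forall>q\<in>carrier M2. \<rho>1 p = \<rho>2 q + vf_act M1 \<zeta>1 (\<lambda>x. ln (f x)) p"
    | (base) "eq_vf ?M \<zeta> (lift1 \<zeta>1)" "killing_field M1 g1 \<zeta>1"
    | (fibre) "eq_vf ?M \<zeta> (lift2 \<zeta>2)" "killing_field M2 g2 \<zeta>2"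
    | (both) "killing_field M1 g1 \<zeta>1" "killing_field M2 g2 \<zeta>2" "\<forall>p\<in>carrier M1. vf_act M1 \<zeta>1 f p = 0"
    using assms(9) by blast
  then show ?thesis
  proof cases
    case conformal
    have ln: "smooth_function M1 (\<lambda>x. ln (f x))"
      unfolding smooth_function_def
      by (auto intro!: smooth_on_ln open_chart_img A sf fpos)
    \<comment> \<open>From \<open>\<zeta>1(ln f) = \<rho>1 - \<rho>2\<close> follows
      \<open>\<zeta>1(f^2) / 2 = (\<rho>1 - \<rho>2) f^2\<close>, which corrects the fibre factor
      \<open>\<rho>2\<close> to \<open>\<rho>1\<close>. So \<open>\<zeta>\<close> is conformal with
      factor \<open>2 \<rho>1\<close> pulled back from the base, and the Einstein factor is a
      function on the base.\<close>
    have "ricci (?g k) z v w = (c - \<rho>1 (fst (chart_inv ?M k z))) * ?g k z v w"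
      if k: "k \<in> charts ?M" and z: "z \<in> chart_img ?M k" for k z v w
    proof -
      obtain i j where ij: "k = (i, j)" "i \<in> charts M1" "j \<in> charts M2" using k by auto
      obtain x y where xy: "z = (x, y)" "x \<in> chart_img M1 i" "y \<in> chart_img M2 j" using z ij by auto
      have pos: "?f i x > 0" using fpos ij xy by blast
      have "pd u (\<lambda>x. ln (?f i x)) x = pd u (?f i) x / ?f i x" for u
        by (rule has_derivative_imp_pd)
          (use pos smooth_on_has_derivative[OF sf[OF ij(2)] xy(2)] in
            \<open>auto intro!: derivative_eq_intros simp: field_simps\<close>)
      then have "\<rho>1 (chart_inv M1 i x) = \<rho>2 (chart_inv M2 j y) + pd (\<zeta>1 i x) (?f i) x / ?f i x"
        using conformal(3) ij xy chart_inv_in[OF xy(2)] chart_inv_in[OF xy(3)] act[OF ln ij(2) xy(2)]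
        by (auto simp: carrier_def)
      then have "pd (\<zeta>1 i x) (?f i) x = (\<rho>1 (chart_inv M1 i x) - \<rho>2 (chart_inv M2 j y)) * ?f i x"
        using pos by (simp add: field_simps)
      then have dF: "pd (\<zeta>1 i x) (\<lambda>x. (?f i x)\<^sup>2) x
          = 2 * (\<rho>1 (chart_inv M1 i x) - \<rho>2 (chart_inv M2 j y)) * (?f i x)\<^sup>2"
        unfolding pdF[OF ij(2) xy(2)] by (simp add: power2_eq_square)
      have lie: "lie_metric (\<zeta>1 i) (g1 i) x (fst v) (fst w)
          = 2 * \<rho>1 (chart_inv M1 i x) * g1 i x (fst v) (fst w)"
        "lie_metric (\<zeta>2 j) (g2 j) y (snd v) (snd w)
          = 2 * \<rho>2 (chart_inv M2 j y) * g2 j y (snd v) (snd w)"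
        using conformal(1,2) ij xy by (auto simp: conformal_field_def)
      have val: "?g (i, j) (x, y) v w = g1 i x (fst v) (fst w) + (?f i x)\<^sup>2 * g2 j y (snd v) (snd w)"
        by (simp add: warped_metric_def)
      have "ricci (?g (i, j)) (x, y) v w = (c - \<rho>1 (chart_inv M1 i x)) * ?g (i, j) (x, y) v w"
        using eq[OF ij(2,3) xy(2,3), of v w] unfolding dF lie val by (simp add: algebra_simps)
      then show ?thesis
        using prod_chart_inv[OF A B, of k z] k z by (simp add: ij xy)
    qed
    moreover have "smooth_function ?M (\<lambda>p. c - \<rho>1 (fst p))"
      using conformal(1) smooth_on_diff[OF open_chart_img[OF A] smooth_on_const[OF open_chart_img[OF A]]]
      by (intro smooth_function_fst[OF A B, of "\<lambda>p. c - \<rho>1 p"])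
        (auto simp: conformal_field_def smooth_function_def)
    ultimately show ?thesis
      using g unfolding einstein_def einstein_with_factor_def by blast
  next
    case base
    show ?thesis
    proof (rule einstein_if_const[OF g, of c])
      fix k z and v w :: "'d \<times> 'e" assume k: "k \<in> charts ?M" and z: "z \<in> chart_img ?M k"
      obtain i j where ij: "k = (i, j)" "i \<in> charts M1" "j \<in> charts M2" using k by auto
      obtain x y where xy: "z = (x, y)" "x \<in> chart_img M1 i" "y \<in> chart_img M2 j" using z ij by auto
      interpret local_warped_killing "chart_img M1 i" "g1 i" "chart_img M2 j" "g2 j" "\<lambda>x. (?f i x)\<^sup>2" "\<zeta>1 i"
        unfolding local_warped_killing_def local_killing_def local_killing_axioms_def
        using local_warped_chart[OF g1 g2 f ij(2,3)] local_metric_chart[OF g1 ij(2)] base(2) X ij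
        by (auto simp: killing_field_def vector_field_def)
      \<comment> \<open>\<open>eq_vf\<close> speaks about points of the product chart; the fixed
        base point \<open>x\<close> serves as partner of \<open>y\<close>.\<close>
      have "\<zeta>2 j y = 0" if "y \<in> chart_img M2 j" for y
        using base(1) ij xy(2) that
        by (force simp: eq_vf_def zeta add_vf_def lift1_def lift2_def)
      then have lie2: "lie_metric (\<zeta>2 j) (g2 j) y v w = 0" if "y \<in> chart_img M2 j" for y v w
        using that by (intro M2.lie_metric_zero_field) auto
      \<comment> \<open>Stated on the whole product chart, because the Bianchi argument
        differentiates this equation.\<close>
      have Ric: "ricci (?g k) (x, y) v w = c * ?g k (x, y) v w
          - pd (\<zeta>1 i x) (\<lambda>x. (?f i x)\<^sup>2) x / 2 * g2 j y (snd v) (snd w)"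
        if "x \<in> chart_img M1 i" "y \<in> chart_img M2 j" for x y v w
        using eq[OF ij(2,3) that, of v w] by (simp add: ij(1) K.killing that lie2)
      have "pd (\<zeta>1 i x) (\<lambda>x. (?f i x)\<^sup>2) x = 0"
        by (rule killing_warping_invariant[of c])
          (use Ric xy in \<open>auto simp: ij(1) warp\<close>)
      then show "ricci (?g k) z v w = c * ?g k z v w"
        using Ric[OF xy(2,3), of v w] by (simp add: xy(1))
    qed
  next
    case fibre
    show ?thesis
    proof (rule einstein_if_const[OF g, of c])
      fix k z and v w :: "'d \<times> 'e" assume k: "k \<in> charts ?M" and z: "z \<in> chart_img ?M k"
      obtain i j where ij: "k = (i, j)" "i \<in> charts M1" "j \<in> charts M2" using k by auto
      obtain x y where xy: "z = (x, y)" "x \<in> chart_img M1 i" "y \<in> chart_img M2 j" using z ij by auto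
      interpret M1: local_metric "chart_img M1 i" "g1 i" by (rule local_metric_chart[OF g1 ij(2)])
      have zero: "\<zeta>1 i x = 0" if "x \<in> chart_img M1 i" for x
        using fibre(1) ij xy(3) that
        by (force simp: eq_vf_def zeta add_vf_def lift1_def lift2_def)
      have "lie_metric (\<zeta>1 i) (g1 i) x (fst v) (fst w) = 0"
        by (rule M1.lie_metric_zero_field[OF zero xy(2)])
      moreover have "lie_metric (\<zeta>2 j) (g2 j) y (snd v) (snd w) = 0"
        using fibre(2) ij xy by (auto simp: killing_field_def)
      moreover have "pd (\<zeta>1 i x) (\<lambda>x. (?f i x)\<^sup>2) x = 0"
        by (simp add: pdF[OF ij(2) xy(2)] zero[OF xy(2)] linear_0[OF linear_pd[OF sf[OF ij(2)] xy(2)]])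
      ultimately show "ricci (?g k) z v w = c * ?g k z v w"
        using eq[OF ij(2,3) xy(2,3), of v w] by (simp add: ij(1) xy(1))
    qed
  next
    case both
    show ?thesis
    proof (rule einstein_if_const[OF g, of c])
      fix k z and v w :: "'d \<times> 'e" assume k: "k \<in> charts ?M" and z: "z \<in> chart_img ?M k"
      obtain i j where ij: "k = (i, j)" "i \<in> charts M1" "j \<in> charts M2" using k by auto
      obtain x y where xy: "z = (x, y)" "x \<in> chart_img M1 i" "y \<in> chart_img M2 j" using z ij by auto
      have "lie_metric (\<zeta>1 i) (g1 i) x (fst v) (fst w) = 0"
        "lie_metric (\<zeta>2 j) (g2 j) y (snd v) (snd w) = 0"
        using both(1,2) ij xy by (auto simp: killing_field_def)
      moreover have "pd (\<zeta>1 i x) (?f i) x = 0"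
        using both(3) chart_inv_in[OF xy(2)] ij act[OF f(1) ij(2) xy(2)] by (auto simp: carrier_def)
      ultimately show "ricci (?g k) z v w = c * ?g k z v w"
        using eq[OF ij(2,3) xy(2,3), of v w] by (simp add: ij(1) xy(1) pdF[OF ij(2) xy(2)])
    qed
  qed
qed

end
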